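(* Let $d\in\mathbb{N}$ and $k\in\{1,2,\dots,d-1\}$, and let $Q=[0,1]^d$. Then there exists a distributionally closed form $\eta\in L^\infty_{\mathrm{cl}}(\mathbb{R}^d,\bigwedge^{k+1}\mathbb{R}^d)$, supported inside $Q$, such that there is no Lipschitz differential $k$-form $\omega$ with $$\mathrm{d}\omega=\eta\quad\text{a.e. in }Q.$$
   Context: $L^\infty_{\mathrm{cl}}(\mathbb{R}^d,\bigwedge^{m}\mathbb{R}^d)$ denotes the space of differential $m$-forms on $\mathbb{R}^d$ with $L^\infty$ coefficients that are distributionally closed, i.e. whose distributional exterior derivative vanishes. For a Lipschitz $k$-form $\omega$ (Lipschitz coefficients), $\mathrm{d}\omega$ is the exterior derivative, defined a.e. by Rademacher's theorem. *)

theory Defs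
  imports "HOL-Analysis.Analysis"
begin

section \<open>Exterior powers in coordinates\<close>

text \<open>
  The exterior algebra of \<open>\<real>\<^sup>d\<close>, \<open>d = CARD('n)\<close>, is \<open>real ^ ('n set)\<close>: the coordinate \<open>a $ I\<close>
  is the coefficient of \<open>dx\<^bsub>i\<^sub>1\<^esub> \<and> \<dots> \<and> dx\<^bsub>i\<^sub>m\<^esub>\<close>, where \<open>I = {i\<^sub>1 < \<dots> < i\<^sub>m}\<close>. The linear order on
  the index type \<open>'n\<close> fixes the orientation of these basis vectors.
\<close>

definition exterior_power :: "nat \<Rightarrow> (real ^ ('n::finite set)) set"
  where "exterior_power m = {a. \<forall>I. card I \<noteq> m \<longrightarrow> a $ I = 0}"

text \<open>
  \<open>dx_wedge j a\<close> is \<open>dx\<^sub>j \<and> a\<close>. For \<open>j \<notin> I\<close> the sign in \<open>dx\<^sub>j \<and> dx\<^sub>I = \<plusminus> dx\<^sub>J\<close>, \<open>J = insert j I\<close>,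
  comes from moving \<open>dx\<^sub>j\<close> past the \<open>dx\<^sub>i\<close> with \<open>i < j\<close>.
\<close>

definition dx_wedge ::
    "'n::{finite,linorder} \<Rightarrow> real ^ ('n set) \<Rightarrow> real ^ ('n set)"
  where "dx_wedge j a =
    (\<chi> J. if j \<in> J then (-1) ^ card {i \<in> J. i < j} * a $ (J - {j}) else 0)"

section \<open>Lipschitz forms and their exterior derivative\<close>

definition lipschitz_form_on ::
    "(real ^ 'n::finite) set \<Rightarrow> nat \<Rightarrow> (real ^ 'n::finite \<Rightarrow> real ^ ('n set)) \<Rightarrow> bool"
  where "lipschitz_form_on S k \<omega> \<longleftrightarrow>
    (\<forall>x\<in>S. \<omega> x \<in> exterior_power k) \<and> (\<exists>L. L-lipschitz_on S \<omega>)"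

text \<open>
  \<open>d\<omega> = (\<Sum>j. dx\<^sub>j \<and> \<partial>\<^sub>j \<omega>)\<close>, at points of differentiability. For Lipschitz \<open>\<omega>\<close> these are almost
  all points (Rademacher).
\<close>

definition has_exterior_derivative_at ::
    "(real ^ 'n::{finite,linorder} \<Rightarrow> real ^ ('n set)) \<Rightarrow> real ^ ('n set) \<Rightarrow> real ^ 'n::{finite,linorder} \<Rightarrow> bool"
  where "has_exterior_derivative_at \<omega> b x \<longleftrightarrow>
    (\<exists>D. (\<omega> has_derivative D) (at x) \<and> b = (\<Sum>j\<in>UNIV. dx_wedge j (D (axis j 1))))"

section \<open>Distributionally closed bounded forms\<close>

definition partial_deriv :: "'n \<Rightarrow> (real ^ 'n::finite \<Rightarrow> real) \<Rightarrow> real ^ 'n::finite \<Rightarrow> real"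
  where "partial_deriv j f x = frechet_derivative f (at x) (axis j 1)"

primrec C_k :: "nat \<Rightarrow> (real ^ 'n::finite \<Rightarrow> real) \<Rightarrow> bool"
  where
    "C_k 0 f \<longleftrightarrow> continuous_on UNIV f"
  | "C_k (Suc r) f \<longleftrightarrow> (\<forall>x. f differentiable (at x)) \<and> (\<forall>j. C_k r (partial_deriv j f))"

definition test_function :: "(real ^ 'n::finite \<Rightarrow> real) \<Rightarrow> bool"
  where "test_function \<phi> \<longleftrightarrow> (\<forall>r. C_k r \<phi>) \<and> compact (closure {x. \<phi> x \<noteq> 0})"

text \<open>
  The distribution \<open>d\<eta> = (\<Sum>j. dx\<^sub>j \<and> \<partial>\<^sub>j \<eta>)\<close>, with values in the exterior algebra, evaluated at a
  test function: each \<open>\<partial>\<^sub>j\<close> is moved to \<open>\<phi>\<close> at the cost of a sign.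
\<close>

definition distr_exterior_derivative ::
    "(real ^ 'n::{finite,linorder} \<Rightarrow> real ^ ('n set)) \<Rightarrow> (real ^ 'n::{finite,linorder} \<Rightarrow> real) \<Rightarrow> real ^ ('n set)"
  where "distr_exterior_derivative \<eta> \<phi> =
    - (LINT x|lebesgue. (\<Sum>j\<in>UNIV. partial_deriv j \<phi> x *\<^sub>R dx_wedge j (\<eta> x)))"

definition L_infinity_form :: "nat \<Rightarrow> (real ^ 'n::finite \<Rightarrow> real ^ ('n set)) \<Rightarrow> bool"
  where "L_infinity_form m \<eta> \<longleftrightarrow>
    (\<forall>x. \<eta> x \<in> exterior_power m) \<and> \<eta> \<in> borel_measurable lebesgue \<and>
    (\<exists>C. AE x in lebesgue. norm (\<eta> x) \<le> C)"

definition L_infinity_closed ::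
    "nat \<Rightarrow> (real ^ 'n::{finite,linorder} \<Rightarrow> real ^ ('n set)) set"
  where "L_infinity_closed m =
    {\<eta>. L_infinity_form m \<eta> \<and> (\<forall>\<phi>. test_function \<phi> \<longrightarrow> distr_exterior_derivative \<eta> \<phi> = 0)}"

definition unit_cube :: "(real ^ 'n::finite) set"
  where "unit_cube = {x. \<forall>i. 0 \<le> x $ i \<and> x $ i \<le> 1}"

end

theory Submission
  imports Defs
begin

text \<open>
  The form is \<open>\<eta> = d(G dx\<^sub>I)\<close> for a set \<open>I\<close> of \<open>k\<close> coordinates and a bounded potential \<open>G\<close>. Only the
  derivatives of \<open>G\<close> in directions outside \<open>I\<close> enter \<open>\<eta>\<close>, so \<open>G\<close> may jump in a direction \<open>q \<in> I\<close>
  and \<open>\<eta>\<close> is still bounded and closed (\<open>potential_form_closed\<close>). Fix \<open>p \<notin> I\<close>. Near the centre of the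
  cube the coefficient of \<open>\<eta>\<close> at \<open>J = I \<union> {p}\<close> is \<open>\<plusminus> cos (\<pi> x\<^sub>p / b)\<close>, and the half-half_wavelength \<open>b\<close>
  is a very irregular function of \<open>x\<^sub>q\<close>: it is the smallest of the lengths \<open>len (i + 1)\<close> such that
  \<open>x\<^sub>q\<close> lies in the set \<open>strip i\<close>, a union of thin intervals repeated with a small period.

  Suppose that \<open>\<omega>\<close> is Lipschitz and \<open>d\<omega> = \<eta>\<close>. The argument is of the type that Burago--Kleiner and
  McMullen used for Jacobians and divergences. Consider a segment of length \<open>len i\<close> in direction
  \<open>e\<^sub>p\<close>, and let \<open>A\<close> be its slope, the increment of \<open>\<omega>\<close> divided by the length. Up to a small shift
  it runs through \<open>strip i\<close>, where \<open>\<eta>\<^sub>J\<close> has half-half_wavelength \<open>b = len (i + 1)\<close>. Cut it into \<open>N = len i / b\<close>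
  pieces. A translation by \<open>b\<close> reverses the sign of \<open>\<eta>\<^sub>J\<close>, so the form \<open>\<omega>(y + b e\<^sub>p) - \<omega>(y)\<close> has an
  exterior derivative of order one on most of a cube of side \<open>b\<close>. By Stokes it cannot be close to the
  constant \<open>b A\<close> there (\<open>oscillation_forces_bending\<close>). Hence the slopes of the \<open>N\<close> pieces have mean
  almost \<open>A\<close> and their mean square distance from \<open>A\<close> is bounded below. By Pythagoras
  the mean of their squared norms exceeds \<open>|A|\<^sup>2\<close> by a fixed amount (\<open>exists_longer_increment\<close>), and so
  some piece, a segment of length \<open>len (i + 1)\<close>, is steeper than the original one by a definite
  amount (\<open>slope_grows\<close>). Iterating over \<open>i\<close> contradicts the Lipschitz bound
  (\<open>no_lipschitz_primitive\<close>).

  Two requirements on the strips compete. Every segment of length \<open>len i\<close> must have a component of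
  \<open>strip i\<close> at a distance much smaller than \<open>len i\<close>. On the other hand the later strips, where the
  half-half_wavelength is shorter, must cover only a small part of each cube of side \<open>len (i + 1)\<close>. The choices
  \<open>period i / len i = 2\<^sup>-\<^sup>i\<close> and \<open>len (i + 1) / period i = 2\<^sup>-\<^sup>i\<close> meet both. It matters that the gain
  in the squared slope does not depend on \<open>N = 4\<^sup>i\<close>, since \<open>N\<close> is unbounded.
\<close>

section \<open>Exterior multiplication by a coordinate differential\<close>

lemma dx_wedge_nth:
  "dx_wedge j a $ J = (if j \<in> J then (-1) ^ card {i \<in> J. i < j} * a $ (J - {j}) else 0)"
  by (simp add: dx_wedge_def)

lemma linear_dx_wedge: "linear (dx_wedge j)"
  by (intro linearI) (simp_all add: vec_eq_iff dx_wedge_nth algebra_simps)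

lemma abs_dx_wedge_nth_le: "\<bar>dx_wedge j a $ J\<bar> \<le> norm a"
  using component_le_norm_cart[of a "J - {j}"] by (simp add: dx_wedge_nth abs_mult power_abs)

text \<open>
  For \<open>i < j\<close> the two signs differ by one transposition: removing \<open>i\<close> from \<open>J\<close> lowers the number of
  elements below \<open>j\<close> by one, and removing \<open>j\<close> does not affect those below \<open>i\<close>.
\<close>

lemma dx_wedge_anticommute_less:
  assumes "i < j"
  shows "dx_wedge i (dx_wedge j a) = - dx_wedge j (dx_wedge i a)"
proof (subst vec_eq_iff, rule allI)
  fix J
  show "dx_wedge i (dx_wedge j a) $ J = (- dx_wedge j (dx_wedge i a)) $ J"
  proof (cases "i \<in> J \<and> j \<in> J")
    case True
    have "{l \<in> J. l < j} = insert i {l \<in> J - {i}. l < j}"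
      using True assms by auto
    then have a: "card {l \<in> J. l < j} = Suc (card {l \<in> J - {i}. l < j})"
      by (simp add: card_insert_if)
    have b: "{l \<in> J - {j}. l < i} = {l \<in> J. l < i}"
      using assms by auto
    have c: "J - {i} - {j} = J - {j} - {i}"
      by auto
    have "dx_wedge i (dx_wedge j a) $ J =
        (-1) ^ card {l \<in> J. l < i} * ((-1) ^ card {l \<in> J - {i}. l < j} * a $ (J - {i} - {j}))"
      using True assms by (subst dx_wedge_nth, subst dx_wedge_nth) auto
    moreover have "dx_wedge j (dx_wedge i a) $ J =
        (-1) ^ card {l \<in> J. l < j} * ((-1) ^ card {l \<in> J - {j}. l < i} * a $ (J - {j} - {i}))"
      using True assms by (subst dx_wedge_nth, subst dx_wedge_nth) auto
    ultimately show ?thesis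
      unfolding a b c by simp
  next
    case False
    then show ?thesis by (auto simp: dx_wedge_nth)
  qed
qed

lemma dx_wedge_dx_wedge_same: "dx_wedge i (dx_wedge i a) = 0"
  by (simp add: vec_eq_iff dx_wedge_nth)

lemma dx_wedge_anticommute: "dx_wedge i (dx_wedge j a) = - dx_wedge j (dx_wedge i a)"
proof -
  consider "i < j" | "i = j" | "j < i" by fastforce
  then show ?thesis
    by cases (simp_all add: dx_wedge_anticommute_less dx_wedge_dx_wedge_same)
qed

section \<open>Lebesgue measure, cubes and tent functions\<close>

lemma borel_measurable_vec_nth [measurable (raw)]:
  fixes f :: "'a \<Rightarrow> real ^ 'i::finite"
  assumes "f \<in> borel_measurable M"
  shows "(\<lambda>x. f x $ i) \<in> borel_measurable M"
  using assms
  by (rule measurable_compose) (intro borel_measurable_continuous_onI continuous_intros)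

lemma AE_lborel_translate:
  fixes c :: "'a::euclidean_space"
  assumes "AE x in lborel. P x"
  shows "AE x in lborel. P (c + x)"
proof -
  have "AE x in distr lborel borel ((+) c). P x"
    using assms by (subst lborel_distr_plus)
  then show ?thesis
    by (rule AE_distrD[rotated]) simp
qed

lemma lborel_integral_translate:
  fixes f :: "'a::euclidean_space \<Rightarrow> real"
  assumes [measurable]: "f \<in> borel_measurable borel"
  shows "(\<integral>x. f (c + x) \<partial>lborel) = (\<integral>x. f x \<partial>lborel)"
proof -
  have "(\<integral>x. f x \<partial>lborel) = (\<integral>x. f x \<partial>distr lborel borel ((+) c))"
    by (simp add: lborel_distr_plus)
  also have "\<dots> = (\<integral>x. f (c + x) \<partial>lborel)"
    by (rule integral_distr) auto
  finally show ?thesis by simp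
qed

lemma lborel_integrable_translate:
  fixes f :: "'a::euclidean_space \<Rightarrow> real"
  assumes "integrable lborel f"
  shows "integrable lborel (\<lambda>x. f (c + x))"
proof -
  have "integrable (distr lborel borel ((+) c)) f"
    using assms by (simp add: lborel_distr_plus)
  then show ?thesis
    by (rule integrable_distr[rotated]) simp
qed

definition cube :: "real ^ 'n \<Rightarrow> real \<Rightarrow> (real ^ 'n::finite) set"
  where "cube z r = {y. \<forall>i. \<bar>y $ i - z $ i\<bar> \<le> r}"

lemma cube_eq_cbox: "cube z r = cbox (z - (\<chi> i. r)) (z + (\<chi> i. r))"
  unfolding cube_def by (auto simp: mem_box_cart abs_le_iff algebra_simps)

lemma compact_cube: "compact (cube z r)"
  by (simp add: cube_eq_cbox)

lemma sets_cube [measurable]: "cube z r \<in> sets borel"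
  by (simp add: cube_eq_cbox)

lemma cube_mono: "r \<le> R \<Longrightarrow> cube z r \<subseteq> cube z R"
  unfolding cube_def by (auto intro: order_trans)

lemma measure_cube:
  fixes z :: "real ^ 'n::finite"
  assumes "0 \<le> r"
  shows "measure lborel (cube z r) = (2 * r) ^ CARD('n)"
proof -
  have "z \<in> cube z r"
    using assms by (simp add: cube_def)
  then have "cube z r \<noteq> {}"
    by blast
  then show ?thesis
    by (simp add: cube_eq_cbox content_cbox_cart)
qed

lemma emeasure_cube_finite: "emeasure lborel (cube z r) < \<infinity>"
  unfolding cube_eq_cbox by (rule emeasure_lborel_cbox_finite)

lemma infnorm_le_iff_cart: "infnorm (x :: real ^ 'n::finite) \<le> r \<longleftrightarrow> (\<forall>i. \<bar>x $ i\<bar> \<le> r)"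
proof
  assume "\<forall>i. \<bar>x $ i\<bar> \<le> r"
  then show "infnorm x \<le> r"
    unfolding infnorm_cart by (intro cSup_least) auto
qed (meson component_le_infnorm_cart order_trans)

lemma mem_cube_iff_infnorm: "y \<in> cube z r \<longleftrightarrow> infnorm (y - z) \<le> r"
  by (simp add: infnorm_le_iff_cart cube_def)

text \<open>
  Most integrands below are bounded and vanish off a cube; this settles their integrability.
\<close>

lemma integrable_bounded_on_cube:
  fixes f :: "real ^ 'n::finite \<Rightarrow> real"
  assumes [measurable]: "f \<in> borel_measurable borel"
    and "\<And>x. x \<notin> cube z r \<Longrightarrow> f x = 0" "\<And>x. x \<in> cube z r \<Longrightarrow> \<bar>f x\<bar> \<le> C"
  shows "integrable lborel f"
proof (rule Bochner_Integration.integrable_bound)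
  show "integrable lborel (\<lambda>x. indicator (cube z r) x * C)"
    using emeasure_cube_finite by (intro integrable_mult_left integrable_real_indicator) auto
  show "AE x in lborel. norm (f x) \<le> norm (indicator (cube z r) x * C)"
    using assms(2,3) by (auto simp: indicator_def intro!: AE_I2) force
qed simp

text \<open>
  A Lipschitz weight supported in a cube. It replaces the indicator function in Stokes' theorem, so
  that boundary integrals over faces turn into volume integrals.
\<close>

definition tent :: "real ^ 'n \<Rightarrow> real \<Rightarrow> real ^ 'n::finite \<Rightarrow> real"
  where "tent z r y = max 0 (r - infnorm (y - z))"

lemma tent_nonneg: "0 \<le> tent z r y"
  and tent_le: "0 \<le> r \<Longrightarrow> tent z r y \<le> r"
  by (simp_all add: tent_def infnorm_pos_le)

lemma tent_eq_0: "y \<notin> cube z r \<Longrightarrow> tent z r y = 0"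
  by (simp add: tent_def mem_cube_iff_infnorm)

lemma tent_lipschitz: "\<bar>tent z r (y + v) - tent z r y\<bar> \<le> norm v"
proof -
  have "\<bar>infnorm (y + v - z) - infnorm (y - z)\<bar> \<le> infnorm v"
    using absdiff_infnorm[of "y + v - z" "y - z"] by (simp add: algebra_simps)
  also have "\<dots> \<le> norm v"
    by (rule infnorm_le_norm)
  finally show ?thesis
    unfolding tent_def by linarith
qed

lemma borel_measurable_tent [measurable]: "tent z r \<in> borel_measurable borel"
  unfolding tent_def
  by (intro borel_measurable_continuous_onI continuous_intros)

text \<open>
  Integration by parts for difference quotients: the translation invariance of Lebesgue measure moves
  the difference from \<open>w\<close> to the weight \<open>\<theta>\<close>. Every integration by parts below is a
  limit of this identity.
\<close>

lemma lborel_integral_difference_by_parts: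
  fixes \<theta> w :: "'a::euclidean_space \<Rightarrow> real"
  assumes 1: "integrable lborel (\<lambda>x. \<theta> x * w x)"
    and 2: "integrable lborel (\<lambda>x. \<theta> x * w (x + v))"
  shows "(\<integral>x. \<theta> x * (w (x + v) - w x) \<partial>lborel) = (\<integral>x. (\<theta> (x - v) - \<theta> x) * w x \<partial>lborel)"
    and "integrable lborel (\<lambda>x. (\<theta> (x - v) - \<theta> x) * w x)"
proof -
  have 3: "integrable lborel (\<lambda>x. \<theta> (x - v) * w x)"
    using lborel_integrable_translate[OF 2, of "- v"] by (simp add: algebra_simps)
  have "(\<integral>x. \<theta> x * (w (x + v) - w x) \<partial>lborel) = (\<integral>x. \<theta> x * w (x + v) \<partial>lborel) - (\<integral>x. \<theta> x * w x \<partial>lborel)"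
    by (simp add: algebra_simps 1 2 Bochner_Integration.integral_diff)
  also have "(\<integral>x. \<theta> x * w (x + v) \<partial>lborel) = (\<integral>x. \<theta> (x - v) * w x \<partial>lborel)"
    using lborel_integral_translate[of "\<lambda>x. \<theta> x * w (x + v)" "- v"] 2 by (simp add: algebra_simps)
  also have "\<dots> - (\<integral>x. \<theta> x * w x \<partial>lborel) = (\<integral>x. (\<theta> (x - v) - \<theta> x) * w x \<partial>lborel)"
    using Bochner_Integration.integral_diff[OF 3 1] by (simp add: left_diff_distrib)
  finally show "(\<integral>x. \<theta> x * (w (x + v) - w x) \<partial>lborel) = (\<integral>x. (\<theta> (x - v) - \<theta> x) * w x \<partial>lborel)" .
  show "integrable lborel (\<lambda>x. (\<theta> (x - v) - \<theta> x) * w x)"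
    using Bochner_Integration.integrable_diff[OF 3 1] by (simp add: algebra_simps)
qed

text \<open>
  The sequential form of a directional derivative, as needed for dominated convergence.
\<close>

lemma has_derivative_difference_quotient:
  fixes f :: "'a::real_normed_vector \<Rightarrow> 'b::real_normed_vector"
  assumes D: "(f has_derivative D) (at x)" and h: "h \<longlonglongrightarrow> 0" "\<And>n. h n \<noteq> (0::real)"
  shows "(\<lambda>n. (1 / h n) *\<^sub>R (f (x + h n *\<^sub>R v) - f x)) \<longlonglongrightarrow> D v"
proof -
  have "((\<lambda>t. x + t *\<^sub>R v) has_derivative (\<lambda>t. t *\<^sub>R v)) (at 0)"
    by (auto intro!: derivative_eq_intros)
  then have "((\<lambda>t. f (x + t *\<^sub>R v)) has_derivative (\<lambda>t. D (t *\<^sub>R v))) (at 0)"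
    using has_derivative_compose[of "\<lambda>t. x + t *\<^sub>R v" _ 0 UNIV f D] D by simp
  then have "((\<lambda>t. f (x + t *\<^sub>R v)) has_vector_derivative D v) (at 0)"
    unfolding has_vector_derivative_def
    using linear_scale[OF has_derivative_linear[OF D]] by simp
  then have *: "((\<lambda>t. norm (f (x + t *\<^sub>R v) - f x - t *\<^sub>R D v) / \<bar>t\<bar>) \<longlongrightarrow> 0) (at 0)"
    by (simp add: has_vector_derivative_def has_derivative_iff_norm)
  have "norm (f (x + t *\<^sub>R v) - f x - t *\<^sub>R D v) / \<bar>t\<bar>
      = norm ((1 / t) *\<^sub>R (f (x + t *\<^sub>R v) - f x) - D v)" if "t \<noteq> 0" for t
  proof -
    have "(1 / t) *\<^sub>R (f (x + t *\<^sub>R v) - f x) - D v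
        = (1 / t) *\<^sub>R (f (x + t *\<^sub>R v) - f x - t *\<^sub>R D v)"
      using that by (simp add: algebra_simps)
    then show ?thesis
      by (simp add: divide_inverse_commute)
  qed
  then have "((\<lambda>t. norm ((1 / t) *\<^sub>R (f (x + t *\<^sub>R v) - f x) - D v)) \<longlongrightarrow> 0) (at 0)"
    by (intro Lim_transform_eventually[OF *]) (simp add: eventually_at_filter)
  then have "((\<lambda>t. (1 / t) *\<^sub>R (f (x + t *\<^sub>R v) - f x)) \<longlongrightarrow> D v) (at 0)"
    by (simp add: tendsto_norm_zero_iff LIM_zero_iff)
  then show ?thesis
    by (rule filterlim_compose) (use h in \<open>simp add: filterlim_at\<close>)
qed

section \<open>Closed forms with a discontinuous potential\<close>

text \<open>
  Differentiability along the lines in direction \<open>i\<close> only. The potential below is discontinuous in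
  another direction, so the Frechet derivative is not available.
\<close>

definition has_partial_derivative ::
    "'n \<Rightarrow> (real ^ 'n::finite \<Rightarrow> real) \<Rightarrow> (real ^ 'n \<Rightarrow> real) \<Rightarrow> bool"
  where "has_partial_derivative i G g \<longleftrightarrow>
    (\<forall>x. ((\<lambda>t. G (x + t *\<^sub>R axis i 1)) has_real_derivative g x) (at 0))"

lemma has_partial_derivative_translate:
  assumes "has_partial_derivative i G g"
  shows "has_partial_derivative i (\<lambda>x. G (x + v)) (\<lambda>x. g (x + v))"
  unfolding has_partial_derivative_def
proof
  fix x
  have "((\<lambda>t. G (x + v + t *\<^sub>R axis i 1)) has_real_derivative g (x + v)) (at 0)"
    using assms by (simp add: has_partial_derivative_def)
  then show "((\<lambda>t. G (x + t *\<^sub>R axis i 1 + v)) has_real_derivative g (x + v)) (at 0)"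
    by (simp add: add_ac)
qed

lemma has_partial_derivative_lipschitz:
  assumes "has_partial_derivative i G g" and C: "\<And>x. \<bar>g x\<bar> \<le> C"
  shows "\<bar>G (x + t *\<^sub>R axis i 1) - G x\<bar> \<le> C * \<bar>t\<bar>"
proof -
  have "((\<lambda>t. G (x + t *\<^sub>R axis i 1)) has_real_derivative g (x + s *\<^sub>R axis i 1)) (at s)" for s
  proof -
    have "((\<lambda>t. G (x + s *\<^sub>R axis i 1 + t *\<^sub>R axis i 1)) has_real_derivative g (x + s *\<^sub>R axis i 1)) (at 0)"
      using assms(1) by (simp add: has_partial_derivative_def)
    then have "((\<lambda>t. G (x + (t + s) *\<^sub>R axis i 1)) has_real_derivative g (x + s *\<^sub>R axis i 1)) (at 0)"
      by (simp add: algebra_simps)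
    then show ?thesis
      using DERIV_shift[of "\<lambda>t. G (x + t *\<^sub>R axis i 1)" _ 0 s] by simp
  qed
  then have "norm (G (x + t *\<^sub>R axis i 1) - G (x + 0 *\<^sub>R axis i 1)) \<le> C * norm (t - 0)"
    by (intro field_differentiable_bound[where S = UNIV and f' = "\<lambda>s. g (x + s *\<^sub>R axis i 1)"])
      (use C in auto)
  then show ?thesis by simp
qed

lemma has_partial_derivative_LIMSEQ:
  assumes "has_partial_derivative i G g" and h: "h \<longlonglongrightarrow> 0" "\<And>n. h n \<noteq> 0"
  shows "(\<lambda>n. (G (x + h n *\<^sub>R axis i 1) - G x) / h n) \<longlonglongrightarrow> g x"
proof -
  have "((\<lambda>t. (G (x + t *\<^sub>R axis i 1) - G x) / t) \<longlongrightarrow> g x) (at 0)"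
    using assms(1)[unfolded has_partial_derivative_def DERIV_def, rule_format, of x] by simp
  then show ?thesis
    by (rule filterlim_compose) (use h in \<open>simp add: filterlim_at\<close>)
qed

text \<open>
  Dominated convergence, with the Lipschitz constant along the lines as the dominating factor.
\<close>

lemma tendsto_integral_difference_quotient:
  assumes G: "has_partial_derivative i G g" "\<And>x. \<bar>g x\<bar> \<le> C"
    and [measurable]: "G \<in> borel_measurable borel" "g \<in> borel_measurable borel"
    and \<theta>: "integrable lborel \<theta>" and h: "h \<longlonglongrightarrow> 0" "\<And>n. h n \<noteq> 0"
  shows "(\<lambda>n. \<integral>x. \<theta> x * ((G (x + h n *\<^sub>R axis i 1) - G x) / h n) \<partial>lborel)
    \<longlonglongrightarrow> (\<integral>x. \<theta> x * g x \<partial>lborel)"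
proof (rule integral_dominated_convergence)
  have [measurable]: "\<theta> \<in> borel_measurable borel"
    using borel_measurable_integrable[OF \<theta>] by simp
  show "(\<lambda>x. \<theta> x * g x) \<in> borel_measurable lborel"
    "(\<lambda>x. \<theta> x * ((G (x + h n *\<^sub>R axis i 1) - G x) / h n)) \<in> borel_measurable lborel" for n
    by measurable
  show "integrable lborel (\<lambda>x. \<bar>\<theta> x\<bar> * C)"
    using \<theta> by simp
  show "AE x in lborel. (\<lambda>n. \<theta> x * ((G (x + h n *\<^sub>R axis i 1) - G x) / h n)) \<longlonglongrightarrow> \<theta> x * g x"
    by (intro AE_I2 tendsto_mult tendsto_const has_partial_derivative_LIMSEQ[OF G(1) h])
  show "AE x in lborel. norm (\<theta> x * ((G (x + h n *\<^sub>R axis i 1) - G x) / h n)) \<le> \<bar>\<theta> x\<bar> * C" for n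
  proof (rule AE_I2)
    fix x
    have "\<bar>(G (x + h n *\<^sub>R axis i 1) - G x) / h n\<bar> \<le> C"
      using has_partial_derivative_lipschitz[OF G, of x "h n"] h(2)[of n]
      by (simp add: abs_divide divide_le_eq)
    then show "norm (\<theta> x * ((G (x + h n *\<^sub>R axis i 1) - G x) / h n)) \<le> \<bar>\<theta> x\<bar> * C"
      unfolding real_norm_def abs_mult by (intro mult_left_mono) auto
  qed
qed

lemma test_function_C1:
  assumes "test_function \<phi>"
  shows "continuous_on UNIV \<phi>"
    and "continuous_on UNIV (partial_deriv j \<phi>)"
    and "has_partial_derivative j \<phi> (partial_deriv j \<phi>)"
proof -
  have "C_k 0 \<phi>" "C_k (Suc 0) \<phi>"
    using assms unfolding test_function_def by blast+
  then show "continuous_on UNIV \<phi>" "continuous_on UNIV (partial_deriv j \<phi>)"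
    by auto
  have 1: "\<phi> differentiable at x" for x
    using \<open>C_k (Suc 0) \<phi>\<close> by simp
  show "has_partial_derivative j \<phi> (partial_deriv j \<phi>)"
    unfolding has_partial_derivative_def
  proof
    fix x
    have D: "(\<phi> has_derivative frechet_derivative \<phi> (at x)) (at x)"
      using 1 by (simp add: frechet_derivative_works)
    have "((\<lambda>t. x + t *\<^sub>R axis j 1) has_derivative (\<lambda>t. t *\<^sub>R axis j 1)) (at (0::real))"
      by (auto intro!: derivative_eq_intros)
    from has_derivative_compose[OF this, of \<phi> "frechet_derivative \<phi> (at x)"] D
    have "((\<lambda>t. \<phi> (x + t *\<^sub>R axis j 1)) has_derivative
        (\<lambda>t. frechet_derivative \<phi> (at x) (t *\<^sub>R axis j 1))) (at 0)"
      by simp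
    then show "((\<lambda>t. \<phi> (x + t *\<^sub>R axis j 1)) has_real_derivative partial_deriv j \<phi> x) (at 0)"
      unfolding has_field_derivative_def partial_deriv_def
      using linear_scale[OF has_derivative_linear[OF D]] by (simp add: mult_commute_abs)
  qed
qed

text \<open>
  The cube is enlarged by \<open>1\<close> so that difference quotients with step at most \<open>1\<close> vanish outside as well.
\<close>

lemma test_function_support:
  fixes \<phi> :: "real ^ 'n::finite \<Rightarrow> real"
  assumes "test_function \<phi>"
  shows "\<exists>R. (\<forall>x. x \<notin> cube 0 R \<longrightarrow> \<phi> x = 0) \<and>
    (\<forall>x j. x \<notin> cube 0 (R + 1) \<longrightarrow> partial_deriv j \<phi> x = 0) \<and>
    (\<forall>x j t. x \<notin> cube 0 (R + 1) \<longrightarrow> \<bar>t\<bar> \<le> 1 \<longrightarrow> \<phi> (x + t *\<^sub>R axis j 1) = 0)"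
proof -
  have "bounded (closure {x. \<phi> x \<noteq> 0})"
    using assms by (auto simp: test_function_def intro: compact_imp_bounded)
  then have "bounded {x. \<phi> x \<noteq> 0}"
    by (rule bounded_subset) (rule closure_subset)
  then obtain R where R: "\<And>x. \<phi> x \<noteq> 0 \<Longrightarrow> norm x \<le> R"
    unfolding bounded_iff by auto
  have 1: "\<phi> x = 0" if "x \<notin> cube 0 R" for x
    using R[of x] that infnorm_le_norm[of x] by (auto simp: mem_cube_iff_infnorm)
  have 2: "\<phi> (x + t *\<^sub>R axis j 1) = 0" if "x \<notin> cube 0 (R + 1)" "\<bar>t\<bar> \<le> 1" for x t j
  proof (rule 1)
    have "infnorm x \<le> infnorm (x + t *\<^sub>R axis j 1) + infnorm (- (t *\<^sub>R axis j (1::real)) :: real ^ 'n)"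
      using infnorm_triangle[of "x + t *\<^sub>R axis j 1" "- (t *\<^sub>R axis j 1)"] by simp
    also have "infnorm (- (t *\<^sub>R axis j (1::real)) :: real ^ 'n) \<le> 1"
      using infnorm_le_norm[of "- (t *\<^sub>R axis j (1::real)) :: real ^ 'n"] that by (simp add: norm_axis_1)
    finally show "x + t *\<^sub>R axis j 1 \<notin> cube 0 R"
      using that by (simp add: mem_cube_iff_infnorm)
  qed
  have "partial_deriv j \<phi> x = 0" if "x \<notin> cube 0 (R + 1)" for x j
  proof -
    have "(\<lambda>n. (\<phi> (x + inverse (real (Suc n)) *\<^sub>R axis j 1) - \<phi> x) / inverse (real (Suc n)))
        \<longlonglongrightarrow> partial_deriv j \<phi> x"
      by (intro has_partial_derivative_LIMSEQ[OF test_function_C1(3)[OF assms]]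
          LIMSEQ_inverse_real_of_nat) simp
    moreover have "\<phi> (x + inverse (real (Suc n)) *\<^sub>R axis j 1) = 0" for n
      using 2[OF that, of "inverse (real (Suc n))" j] by (simp add: inverse_le_1_iff)
    moreover have "\<phi> x = 0"
      using 2[OF that, of 0] by simp
    ultimately show ?thesis
      by (simp add: LIMSEQ_const_iff)
  qed
  with 1 2 show ?thesis
    by blast
qed

lemma test_function_bounded:
  assumes "test_function \<phi>"
  shows "\<exists>B. \<forall>x. \<bar>\<phi> x\<bar> \<le> B \<and> \<bar>partial_deriv j \<phi> x\<bar> \<le> B"
proof -
  have *: "\<exists>B. \<forall>x. \<bar>f x\<bar> \<le> B" if c: "continuous_on UNIV f" and z: "\<And>x. x \<notin> cube 0 R \<Longrightarrow> f x = 0"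
    for f :: "real ^ 'a \<Rightarrow> real" and R
  proof -
    have "bounded (f ` cube 0 R)"
      by (intro compact_imp_bounded compact_continuous_image compact_cube continuous_on_subset[OF c]) auto
    then obtain B where "0 < B" "\<And>x. x \<in> cube 0 R \<Longrightarrow> \<bar>f x\<bar> \<le> B"
      unfolding bounded_pos by auto
    moreover have "\<bar>f x\<bar> \<le> B" if "x \<notin> cube 0 R" for x
      using z[OF that] \<open>0 < B\<close> by simp
    ultimately show ?thesis
      by blast
  qed
  obtain R where R: "\<And>x. x \<notin> cube 0 R \<Longrightarrow> \<phi> x = 0"
    "\<And>x j. x \<notin> cube 0 (R + 1) \<Longrightarrow> partial_deriv j \<phi> x = 0"
    "\<And>x j t. x \<notin> cube 0 (R + 1) \<Longrightarrow> \<bar>t\<bar> \<le> 1 \<Longrightarrow> \<phi> (x + t *\<^sub>R axis j 1) = 0"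
    using test_function_support[OF assms] by blast
  obtain B where B: "\<forall>x. \<bar>\<phi> x\<bar> \<le> B"
    using *[OF test_function_C1(1)[OF assms] R(1)] by blast
  obtain B' where B': "\<forall>x. \<bar>partial_deriv j \<phi> x\<bar> \<le> B'"
    using *[OF test_function_C1(2)[OF assms] R(2)] by blast
  show ?thesis
    by (rule exI[of _ "max B B'"]) (use B B' in \<open>simp add: le_max_iff_disj\<close>)
qed

lemma test_function_measurable:
  assumes "test_function \<phi>"
  shows "\<phi> \<in> borel_measurable borel" "partial_deriv j \<phi> \<in> borel_measurable borel"
  using test_function_C1[OF assms] by (auto intro: borel_measurable_continuous_onI)

lemma test_function_integrable:
  assumes \<phi>: "test_function \<phi>" and [measurable]: "f \<in> borel_measurable borel" and f: "\<And>x. \<bar>f x\<bar> \<le> A"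
  shows "integrable lborel (\<lambda>x. \<phi> x * f x)" "integrable lborel (\<lambda>x. partial_deriv j \<phi> x * f x)"
proof -
  note [measurable] = test_function_measurable[OF \<phi>]
  obtain B where B: "\<And>x. \<bar>\<phi> x\<bar> \<le> B" "\<And>x. \<bar>partial_deriv j \<phi> x\<bar> \<le> B"
    using test_function_bounded[OF \<phi>] by blast
  have "0 \<le> B"
    using B(1)[of 0] by linarith
  obtain R where R: "\<And>x. x \<notin> cube 0 R \<Longrightarrow> \<phi> x = 0"
    "\<And>x j. x \<notin> cube 0 (R + 1) \<Longrightarrow> partial_deriv j \<phi> x = 0"
    "\<And>x j t. x \<notin> cube 0 (R + 1) \<Longrightarrow> \<bar>t\<bar> \<le> 1 \<Longrightarrow> \<phi> (x + t *\<^sub>R axis j 1) = 0"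
    using test_function_support[OF \<phi>] by blast
  have le: "\<bar>\<phi> x * f x\<bar> \<le> B * A" "\<bar>partial_deriv j \<phi> x * f x\<bar> \<le> B * A" for x
    unfolding abs_mult using B f \<open>0 \<le> B\<close> by (auto intro: mult_mono)
  show "integrable lborel (\<lambda>x. \<phi> x * f x)"
  proof (rule integrable_bounded_on_cube)
    show "\<phi> x * f x = 0" if "x \<notin> cube 0 R" for x
      using R(1)[OF that] by simp
  qed (use le(1) in simp_all)
  show "integrable lborel (\<lambda>x. partial_deriv j \<phi> x * f x)"
  proof (rule integrable_bounded_on_cube)
    show "partial_deriv j \<phi> x * f x = 0" if "x \<notin> cube 0 (R + 1)" for x
      using R(2)[OF that] by simp
  qed (use le(2) in simp_all)
qed

text \<open>
  Here \<open>f\<close> is bounded but need not be integrable. The compact support of \<open>\<phi>\<close> makes up for it, since \<open>f\<close> may be cut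
  off outside a cube.
\<close>

lemma tendsto_integral_test_difference_quotient:
  assumes \<phi>: "test_function \<phi>" and [measurable]: "f \<in> borel_measurable borel" and f: "\<And>x. \<bar>f x\<bar> \<le> A"
    and h: "h \<longlonglongrightarrow> 0" "\<And>n. h n \<noteq> 0" "\<And>n. \<bar>h n\<bar> \<le> 1"
  shows "(\<lambda>n. \<integral>x. f x * ((\<phi> (x + h n *\<^sub>R axis j 1) - \<phi> x) / h n) \<partial>lborel)
    \<longlonglongrightarrow> (\<integral>x. f x * partial_deriv j \<phi> x \<partial>lborel)"
proof -
  obtain R where R: "\<And>x. x \<notin> cube 0 R \<Longrightarrow> \<phi> x = 0"
    "\<And>x j. x \<notin> cube 0 (R + 1) \<Longrightarrow> partial_deriv j \<phi> x = 0"
    "\<And>x j t. x \<notin> cube 0 (R + 1) \<Longrightarrow> \<bar>t\<bar> \<le> 1 \<Longrightarrow> \<phi> (x + t *\<^sub>R axis j 1) = 0"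
    using test_function_support[OF \<phi>] by blast
  have R0: "\<phi> x = 0" if "x \<notin> cube 0 (R + 1)" for x
    using R(3)[OF that, of 0] by simp
  obtain B where B: "\<And>x. \<bar>\<phi> x\<bar> \<le> B" "\<And>x. \<bar>partial_deriv j \<phi> x\<bar> \<le> B"
    using test_function_bounded[OF \<phi>] by blast
  define f0 where "f0 x = indicator (cube 0 (R + 1)) x * f x" for x
  have "integrable lborel f0"
    unfolding f0_def
    by (rule integrable_bounded_on_cube[where z = 0 and r = "R + 1" and C = A])
      (use f in simp_all)
  then have "(\<lambda>n. \<integral>x. f0 x * ((\<phi> (x + h n *\<^sub>R axis j 1) - \<phi> x) / h n) \<partial>lborel)
      \<longlonglongrightarrow> (\<integral>x. f0 x * partial_deriv j \<phi> x \<partial>lborel)"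
    by (intro tendsto_integral_difference_quotient[OF test_function_C1(3)[OF \<phi>] B(2)] h
        test_function_measurable[OF \<phi>])
  moreover have "f0 x * partial_deriv j \<phi> x = f x * partial_deriv j \<phi> x" for x
    using R(2)[of x] by (auto simp: f0_def indicator_def)
  moreover have "f0 x * ((\<phi> (x + h n *\<^sub>R axis j 1) - \<phi> x) / h n)
      = f x * ((\<phi> (x + h n *\<^sub>R axis j 1) - \<phi> x) / h n)" for x n
    using R(3)[of x "h n"] R0[of x] h(3) by (auto simp: f0_def indicator_def)
  ultimately show ?thesis
    by (simp only:)
qed

lemma integral_by_parts_test_function:
  assumes \<phi>: "test_function \<phi>"
    and G: "has_partial_derivative i G g" "\<And>x. \<bar>g x\<bar> \<le> C" "\<And>x. \<bar>G x\<bar> \<le> A"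
    and [measurable]: "G \<in> borel_measurable borel" "g \<in> borel_measurable borel"
  shows "(\<integral>x. \<phi> x * g x \<partial>lborel) = - (\<integral>x. partial_deriv i \<phi> x * G x \<partial>lborel)"
proof -
  note [measurable] = test_function_measurable[OF \<phi>]
  define h where "h n = inverse (real (Suc n))" for n
  have h: "h \<longlonglongrightarrow> 0" "h n \<noteq> 0" "\<bar>h n\<bar> \<le> 1" for n
    unfolding h_def by (rule LIMSEQ_inverse_real_of_nat) (simp_all add: inverse_le_1_iff)
  have h': "(\<lambda>n. - h n) \<longlonglongrightarrow> 0" "- h n \<noteq> 0" "\<bar>- h n\<bar> \<le> 1" for n
    using h tendsto_minus[OF h(1)] by auto
  have "integrable lborel \<phi>"
    using test_function_integrable(1)[OF \<phi>, of "\<lambda>_. 1" 1] by simp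
  then have 1: "(\<lambda>n. \<integral>x. \<phi> x * ((G (x + h n *\<^sub>R axis i 1) - G x) / h n) \<partial>lborel)
      \<longlonglongrightarrow> (\<integral>x. \<phi> x * g x \<partial>lborel)"
    by (intro tendsto_integral_difference_quotient[OF G(1,2)] h) simp_all
  have 2: "(\<lambda>n. \<integral>x. G x * ((\<phi> (x + (- h n) *\<^sub>R axis i 1) - \<phi> x) / (- h n)) \<partial>lborel)
      \<longlonglongrightarrow> (\<integral>x. G x * partial_deriv i \<phi> x \<partial>lborel)"
    by (rule tendsto_integral_test_difference_quotient[OF \<phi> _ G(3) h']) simp
  have "(\<integral>x. \<phi> x * ((G (x + h n *\<^sub>R axis i 1) - G x) / h n) \<partial>lborel)
      = - (\<integral>x. G x * ((\<phi> (x + (- h n) *\<^sub>R axis i 1) - \<phi> x) / (- h n)) \<partial>lborel)" for n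
  proof -
    have "(\<integral>x. \<phi> x * (G (x + h n *\<^sub>R axis i 1) - G x) \<partial>lborel)
        = (\<integral>x. (\<phi> (x - h n *\<^sub>R axis i 1) - \<phi> x) * G x \<partial>lborel)"
      by (intro lborel_integral_difference_by_parts(1) test_function_integrable(1)[OF \<phi>, where A = A])
        (use G(3) in auto)
    moreover have "(\<integral>x. \<phi> x * ((G (x + h n *\<^sub>R axis i 1) - G x) / h n) \<partial>lborel)
        = (\<integral>x. \<phi> x * (G (x + h n *\<^sub>R axis i 1) - G x) \<partial>lborel) / h n"
      by simp
    moreover have "(\<integral>x. G x * ((\<phi> (x + (- h n) *\<^sub>R axis i 1) - \<phi> x) / (- h n)) \<partial>lborel)
        = (\<integral>x. G x * (\<phi> (x - h n *\<^sub>R axis i 1) - \<phi> x) \<partial>lborel) / (- h n)"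
      by simp
    ultimately show ?thesis
      by (simp only: mult.commute[of "G _"] divide_minus_right minus_minus)
  qed
  with 1 have "(\<lambda>n. - (\<integral>x. G x * ((\<phi> (x + (- h n) *\<^sub>R axis i 1) - \<phi> x) / (- h n)) \<partial>lborel))
      \<longlonglongrightarrow> (\<integral>x. \<phi> x * g x \<partial>lborel)"
    by (simp only:)
  from LIMSEQ_unique[OF this tendsto_minus[OF 2]] show ?thesis
    by (simp add: mult.commute)
qed

text \<open>
  Both sides are formally \<open>- \<integral> \<partial>\<^sub>i\<partial>\<^sub>j\<phi> G\<close>. Second derivatives are avoided: one derivative
  is kept as a difference quotient, which commutes with the other derivative because a translate of \<open>G\<close> satisfies
  the hypotheses as well.
\<close>

lemma integral_mixed_partial_derivatives:
  assumes \<phi>: "test_function \<phi>" and A: "\<And>x. \<bar>G x\<bar> \<le> A"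
    and gi: "has_partial_derivative i G gi" "\<And>x. \<bar>gi x\<bar> \<le> C"
    and gj: "has_partial_derivative j G gj" "\<And>x. \<bar>gj x\<bar> \<le> C"
    and [measurable]: "G \<in> borel_measurable borel" "gi \<in> borel_measurable borel" "gj \<in> borel_measurable borel"
  shows "(\<integral>x. partial_deriv i \<phi> x * gj x \<partial>lborel) = (\<integral>x. partial_deriv j \<phi> x * gi x \<partial>lborel)"
proof -
  note [measurable] = test_function_measurable[OF \<phi>]
  define h where "h n = inverse (real (Suc n))" for n
  have h: "h \<longlonglongrightarrow> 0" "h n \<noteq> 0" "\<bar>h n\<bar> \<le> 1" for n
    unfolding h_def by (rule LIMSEQ_inverse_real_of_nat) (simp_all add: inverse_le_1_iff)
  have h': "(\<lambda>n. - h n) \<longlonglongrightarrow> 0" "- h n \<noteq> 0" "\<bar>- h n\<bar> \<le> 1" for n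
    using h tendsto_minus[OF h(1)] by auto
  have "integrable lborel (partial_deriv i \<phi>)"
    using test_function_integrable(2)[OF \<phi>, of "\<lambda>_. 1" 1 i] by simp
  then have 1: "(\<lambda>n. \<integral>x. partial_deriv i \<phi> x * ((G (x + h n *\<^sub>R axis j 1) - G x) / h n) \<partial>lborel)
      \<longlonglongrightarrow> (\<integral>x. partial_deriv i \<phi> x * gj x \<partial>lborel)"
    by (intro tendsto_integral_difference_quotient[OF gj] h) simp_all
  have 2: "(\<lambda>n. \<integral>x. gi x * ((\<phi> (x + (- h n) *\<^sub>R axis j 1) - \<phi> x) / (- h n)) \<partial>lborel)
      \<longlonglongrightarrow> (\<integral>x. gi x * partial_deriv j \<phi> x \<partial>lborel)"
    by (rule tendsto_integral_test_difference_quotient[OF \<phi> _ gi(2) h']) simp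
  have "(\<integral>x. partial_deriv i \<phi> x * ((G (x + h n *\<^sub>R axis j 1) - G x) / h n) \<partial>lborel)
      = (\<integral>x. gi x * ((\<phi> (x + (- h n) *\<^sub>R axis j 1) - \<phi> x) / (- h n)) \<partial>lborel)" for n
  proof -
    let ?v = "h n *\<^sub>R axis j (1::real) :: real ^ 'a"
    have int: "integrable lborel (\<lambda>x. \<phi> x * gi x)" "integrable lborel (\<lambda>x. \<phi> x * gi (x + ?v))"
      "integrable lborel (\<lambda>x. partial_deriv i \<phi> x * G x)"
      "integrable lborel (\<lambda>x. partial_deriv i \<phi> x * G (x + ?v))"
      using gi(2) A
      by (auto intro!: test_function_integrable(1)[OF \<phi>, where A = C] test_function_integrable(2)[OF \<phi>, where A = A])
    \<comment> \<open>integration by parts for the translate of \<open>G\<close> by \<open>h n\<close> in direction \<open>j\<close>\<close>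
    have "(\<integral>x. \<phi> x * gi (x + ?v) \<partial>lborel) = - (\<integral>x. partial_deriv i \<phi> x * G (x + ?v) \<partial>lborel)"
      by (rule integral_by_parts_test_function[OF \<phi> has_partial_derivative_translate[OF gi(1)]])
        (use gi(2) A in auto)
    moreover have "(\<integral>x. \<phi> x * gi x \<partial>lborel) = - (\<integral>x. partial_deriv i \<phi> x * G x \<partial>lborel)"
      by (rule integral_by_parts_test_function[OF \<phi> gi A]) auto
    ultimately have "(\<integral>x. \<phi> x * (gi (x + ?v) - gi x) \<partial>lborel)
        = - (\<integral>x. partial_deriv i \<phi> x * (G (x + ?v) - G x) \<partial>lborel)"
      using int by (simp add: right_diff_distrib Bochner_Integration.integral_diff)
    moreover have "(\<integral>x. \<phi> x * (gi (x + ?v) - gi x) \<partial>lborel) = (\<integral>x. (\<phi> (x - ?v) - \<phi> x) * gi x \<partial>lborel)"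
      by (intro lborel_integral_difference_by_parts(1) int)
    moreover have "(\<integral>x. partial_deriv i \<phi> x * ((G (x + ?v) - G x) / h n) \<partial>lborel)
        = (\<integral>x. partial_deriv i \<phi> x * (G (x + ?v) - G x) \<partial>lborel) / h n"
      by simp
    moreover have "(\<integral>x. gi x * ((\<phi> (x + (- h n) *\<^sub>R axis j 1) - \<phi> x) / (- h n)) \<partial>lborel)
        = (\<integral>x. gi x * (\<phi> (x - ?v) - \<phi> x) \<partial>lborel) / (- h n)"
      by simp
    ultimately show ?thesis
      by (simp only: mult.commute[of "gi _"] divide_minus_right minus_divide_left minus_minus)
  qed
  with 1 have "(\<lambda>n. \<integral>x. gi x * ((\<phi> (x + (- h n) *\<^sub>R axis j 1) - \<phi> x) / (- h n)) \<partial>lborel)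
      \<longlonglongrightarrow> (\<integral>x. partial_deriv i \<phi> x * gj x \<partial>lborel)"
    by (simp only:)
  from LIMSEQ_unique[OF this 2] show ?thesis
    by (simp add: mult.commute)
qed

lemma dx_wedge_axis_eq_0: "i \<in> I \<Longrightarrow> dx_wedge i (axis I c) = 0"
  by (auto simp: vec_eq_iff dx_wedge_nth axis_def)

text \<open>
  This is \<open>d(G dx\<^sub>I)\<close> if \<open>g j = \<partial>\<^sub>j G\<close>. The sum omits \<open>j \<in> I\<close>, where \<open>dx\<^sub>j \<and> dx\<^sub>I = 0\<close>.
\<close>

definition potential_form ::
    "'n set \<Rightarrow> ('n \<Rightarrow> real ^ 'n::{finite,linorder} \<Rightarrow> real)
      \<Rightarrow> real ^ 'n::{finite,linorder} \<Rightarrow> real ^ ('n set)"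
  where "potential_form I g x = (\<Sum>j\<in>-I. g j x *\<^sub>R dx_wedge j (axis I 1))"

text \<open>
  The pairing of \<open>d\<eta>\<close> with \<open>\<phi>\<close> is a sum over \<open>i\<close> and \<open>j\<close> of a coefficient that is symmetric in \<open>i\<close> and \<open>j\<close>, by
  \<open>integral_mixed_partial_derivatives\<close>, times \<open>dx\<^sub>i \<and> dx\<^sub>j \<and> dx\<^sub>I\<close>, which is antisymmetric and
  vanishes unless \<open>i\<close> and \<open>j\<close> lie outside \<open>I\<close>.
\<close>

lemma potential_form_closed:
  fixes I :: "'n::{finite,linorder} set"
  assumes G [measurable]: "G \<in> borel_measurable borel" and A: "\<And>x. \<bar>G x\<bar> \<le> A"
    and g [measurable]: "\<And>j. g j \<in> borel_measurable borel" and C: "\<And>j x. \<bar>g j x\<bar> \<le> C"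
    and deriv: "\<And>j. j \<notin> I \<Longrightarrow> has_partial_derivative j G (g j)"
  shows "potential_form I g \<in> L_infinity_closed (card I + 1)"
proof -
  have meas [measurable]: "potential_form I g \<in> borel_measurable borel"
    unfolding potential_form_def by measurable
  have ext: "potential_form I g x \<in> exterior_power (card I + 1)" for x
  proof -
    have "dx_wedge j (axis I 1) $ J = 0" if "card J \<noteq> card I + 1" for j J
      using that card_Suc_Diff1[of J j] by (auto simp: dx_wedge_nth axis_def)
    then show ?thesis
      by (auto simp: exterior_power_def potential_form_def intro!: sum.neutral)
  qed
  have leb: "potential_form I g \<in> borel_measurable lebesgue"
    by (rule measurable_completion) simp
  have bdd: "norm (potential_form I g x) \<le> (\<Sum>j\<in>-I. C * norm (dx_wedge j (axis I 1)))" for x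
    unfolding potential_form_def by (intro sum_norm_le) (simp add: mult_right_mono C)
  have closed: "distr_exterior_derivative (potential_form I g) \<phi> = 0" if \<phi>: "test_function \<phi>" for \<phi>
  proof -
    note [measurable] = test_function_measurable[OF \<phi>]
    define m where "m i j = (\<integral>x. partial_deriv i \<phi> x * g j x \<partial>lborel)" for i j
    define e where "e i j = dx_wedge i (dx_wedge j (axis I 1))" for i j
    have e_0: "e i j = 0" if "i \<in> I" for i j
      using that unfolding e_def
      by (subst dx_wedge_anticommute) (simp add: dx_wedge_axis_eq_0 linear_0[OF linear_dx_wedge])
    have int: "integrable lborel (\<lambda>x. partial_deriv i \<phi> x * g j x)" for i j
      by (rule test_function_integrable(2)[OF \<phi> g[of j] C[of j]])
    have "(LINT x|lebesgue. (\<Sum>i\<in>UNIV. partial_deriv i \<phi> x *\<^sub>R dx_wedge i (potential_form I g x)))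
        = (LINT x|lebesgue. (\<Sum>i\<in>UNIV. \<Sum>j\<in>-I. (partial_deriv i \<phi> x * g j x) *\<^sub>R e i j))"
      by (simp add: potential_form_def e_def linear_sum[OF linear_dx_wedge]
          linear_scale[OF linear_dx_wedge] scaleR_sum_right)
    also have "\<dots> = (LINT x|lborel. (\<Sum>i\<in>UNIV. \<Sum>j\<in>-I. (partial_deriv i \<phi> x * g j x) *\<^sub>R e i j))"
      by (rule integral_completion) measurable
    also have "\<dots> = (\<Sum>i\<in>UNIV. \<Sum>j\<in>-I. m i j *\<^sub>R e i j)"
      unfolding m_def using int
      by (simp add: Bochner_Integration.integral_sum Bochner_Integration.integrable_sum)
    also have "\<dots> = (\<Sum>i\<in>-I. \<Sum>j\<in>-I. m i j *\<^sub>R e i j)"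
      by (intro sum.mono_neutral_right) (auto simp: e_0)
    also have "\<dots> = 0" (is "?T = 0")
    proof -
      have "?T = (\<Sum>j\<in>-I. \<Sum>i\<in>-I. m i j *\<^sub>R e i j)"
        by (rule sum.swap)
      also have "\<dots> = (\<Sum>j\<in>-I. \<Sum>i\<in>-I. - (m j i *\<^sub>R e j i))"
      proof (intro sum.cong refl)
        fix i j assume "j \<in> - I" "i \<in> - I"
        then have ij: "has_partial_derivative i G (g i)" "has_partial_derivative j G (g j)"
          by (auto intro: deriv)
        have "m i j = m j i"
          unfolding m_def
          by (rule integral_mixed_partial_derivatives[OF \<phi> A ij(1) C[of i] ij(2) C[of j] G g g])
        moreover have "e i j = - e j i"
          unfolding e_def by (rule dx_wedge_anticommute)
        ultimately show "m i j *\<^sub>R e i j = - (m j i *\<^sub>R e j i)"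
          by simp
      qed
      also have "\<dots> = - ?T"
        by (simp add: sum_negf)
      finally have T: "?T + ?T = 0"
        by (simp only: eq_neg_iff_add_eq_0)
      show ?thesis
        using scaleR_half_double[of ?T] unfolding T scaleR_zero_right by (rule sym)
    qed
    finally show ?thesis
      by (simp add: distr_exterior_derivative_def)
  qed
  have "\<exists>B. AE x in lebesgue. norm (potential_form I g x) \<le> B"
    by (rule exI, rule AE_I2, rule bdd)
  then have "L_infinity_form (card I + 1) (potential_form I g)"
    unfolding L_infinity_form_def using ext leb by (intro conjI allI)
  then show ?thesis
    unfolding L_infinity_closed_def using closed by (intro CollectI conjI allI impI)
qed

section \<open>Testing the exterior derivative of a Lipschitz form\<close>

lemma has_exterior_derivative_at_translate:
  assumes "has_exterior_derivative_at \<omega> b (y + v)"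
  shows "has_exterior_derivative_at (\<lambda>y. \<omega> (y + v)) b y"
proof -
  obtain D where D: "(\<omega> has_derivative D) (at (y + v))" "b = (\<Sum>j\<in>UNIV. dx_wedge j (D (axis j 1)))"
    using assms unfolding has_exterior_derivative_at_def by blast
  have "((\<lambda>y. y + v) has_derivative (\<lambda>h. h)) (at y)"
    by (auto intro!: derivative_eq_intros)
  from has_derivative_compose[OF this D(1)] D(2) show ?thesis
    unfolding has_exterior_derivative_at_def by blast
qed

lemma has_exterior_derivative_at_diff:
  assumes "has_exterior_derivative_at \<omega> b y" "has_exterior_derivative_at \<omega>' b' y"
  shows "has_exterior_derivative_at (\<lambda>y. \<omega> y - \<omega>' y - a) (b - b') y"
proof -
  obtain D where D: "(\<omega> has_derivative D) (at y)" "b = (\<Sum>j\<in>UNIV. dx_wedge j (D (axis j 1)))"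
    using assms(1) unfolding has_exterior_derivative_at_def by blast
  obtain D' where D': "(\<omega>' has_derivative D') (at y)" "b' = (\<Sum>j\<in>UNIV. dx_wedge j (D' (axis j 1)))"
    using assms(2) unfolding has_exterior_derivative_at_def by blast
  have "((\<lambda>y. \<omega> y - \<omega>' y - a) has_derivative (\<lambda>h. D h - D' h - 0)) (at y)"
    by (intro has_derivative_diff D D' has_derivative_const)
  then have "((\<lambda>y. \<omega> y - \<omega>' y - a) has_derivative (\<lambda>h. D h - D' h)) (at y)"
    by simp
  moreover have "b - b' = (\<Sum>j\<in>UNIV. dx_wedge j (D (axis j 1) - D' (axis j 1)))"
    by (simp add: D D' linear_diff[OF linear_dx_wedge] sum_subtractf)
  ultimately show ?thesis
    unfolding has_exterior_derivative_at_def by blast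
qed

text \<open>
  A quantitative form of Stokes' theorem: if \<open>u\<close> is small in mean, the weighted mean of \<open>du\<close> is small.
  After integration by parts the derivative falls on the tent function, whose Lipschitz constant is \<open>1\<close>.
  The larger cube leaves room for the steps of the difference quotients.
\<close>

lemma exterior_derivative_tested:
  fixes u :: "real ^ 'n::{finite,linorder} \<Rightarrow> real ^ ('n set)"
  assumes r: "0 < r" "r < R" and L: "L-lipschitz_on (cube z R) u"
    and \<beta> [measurable]: "\<beta> \<in> borel_measurable borel"
    and d: "AE y in lborel. y \<in> cube z r \<longrightarrow> has_exterior_derivative_at u (\<beta> y) y"
  shows "\<bar>\<integral>y. tent z r y * \<beta> y $ J \<partial>lborel\<bar>
    \<le> CARD('n) * (\<integral>y. indicator (cube z R) y * norm (u y) \<partial>lborel)"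
proof -
  define u0 where "u0 y = indicator (cube z R) y *\<^sub>R u y" for y
  define w where "w j y = dx_wedge j (u0 y) $ J" for j y
  define h where "h n = (R - r) * inverse (real (Suc n))" for n
  have h: "0 < h n" "h n \<le> R - r" for n
    using r mult_left_le[of "inverse (real (Suc n))" "R - r"]
    by (auto simp: h_def inverse_le_1_iff)
  have h0: "h \<longlonglongrightarrow> 0"
    unfolding h_def by (intro tendsto_mult_right_zero LIMSEQ_inverse_real_of_nat)
  have contu: "continuous_on (cube z R) u"
    using L by (rule lipschitz_on_continuous_on)
  have u0 [measurable]: "u0 \<in> borel_measurable borel"
    unfolding u0_def by (rule borel_measurable_continuous_on_indicator) (auto intro: contu)
  obtain B where B: "\<And>y. norm (u0 y) \<le> B"
  proof -
    have "bounded (u ` cube z R)"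
      using contu compact_cube by (intro compact_imp_bounded compact_continuous_image)
    then obtain B where "\<And>y. y \<in> cube z R \<Longrightarrow> norm (u y) \<le> B" "0 \<le> B"
      unfolding bounded_pos by (auto intro: less_imp_le)
    then show ?thesis
      by (intro that[of B]) (auto simp: u0_def indicator_def)
  qed
  have w_le: "\<bar>w j y\<bar> \<le> norm (u0 y)" for j y
    unfolding w_def by (rule abs_dx_wedge_nth_le)
  have w_meas [measurable]: "w j \<in> borel_measurable borel" for j
    unfolding w_def dx_wedge_nth by (cases "j \<in> J") simp_all
  have w_B: "\<bar>w j y\<bar> \<le> B" for j y
    using w_le B order_trans by blast
  have shift: "y + h n *\<^sub>R axis j 1 \<in> cube z R" if "y \<in> cube z r" for y j n
  proof -
    have "\<bar>y $ i + h n * axis j 1 $ i - z $ i\<bar> \<le> R" for i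
    proof -
      have "\<bar>h n * axis j 1 $ i\<bar> \<le> R - r"
        using h[of n] by (simp add: axis_def)
      moreover have "\<bar>y $ i - z $ i\<bar> \<le> r"
        using that by (simp add: cube_def)
      ultimately show ?thesis by linarith
    qed
    then show ?thesis by (simp add: cube_def)
  qed
  have sub: "y \<in> cube z R" if "y \<in> cube z r" for y
    using that cube_mono[of r R z] r by auto
  \<comment> \<open>difference quotients of \<open>u\<close> assembled like \<open>du\<close>: \<open>S n y\<close> tends to \<open>tent z r y * \<beta> y $ J\<close> wherever \<open>u\<close> is differentiable\<close>
  define S where "S n y = (\<Sum>j\<in>UNIV. tent z r y * (w j (y + h n *\<^sub>R axis j 1) - w j y) / h n)" for n y
  have S_lim: "(\<lambda>n. S n y) \<longlonglongrightarrow> tent z r y * \<beta> y $ J"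
    if dy: "y \<in> cube z r \<longrightarrow> has_exterior_derivative_at u (\<beta> y) y" for y
  proof (cases "y \<in> cube z r")
    case True
    then obtain D where D: "(u has_derivative D) (at y)"
      and \<beta>: "\<beta> y = (\<Sum>j\<in>UNIV. dx_wedge j (D (axis j 1)))"
      using dy unfolding has_exterior_derivative_at_def by blast
    have "(\<lambda>n. dx_wedge j ((1 / h n) *\<^sub>R (u (y + h n *\<^sub>R axis j 1) - u y)) $ J)
        \<longlonglongrightarrow> dx_wedge j (D (axis j 1)) $ J" for j
      using linear_continuous_at[OF linear_conv_bounded_linear[THEN iffD1, OF linear_dx_wedge[of j]]]
      by (intro tendsto_vec_nth isCont_tendsto_compose[of _ "dx_wedge j"]
          has_derivative_difference_quotient[OF D h0]) (use h in \<open>auto simp: less_le\<close>)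
    moreover have "dx_wedge j ((1 / h n) *\<^sub>R (u (y + h n *\<^sub>R axis j 1) - u y)) $ J
        = (w j (y + h n *\<^sub>R axis j 1) - w j y) / h n" for j n
      using sub[OF True] shift[OF True]
      by (simp add: w_def u0_def linear_scale[OF linear_dx_wedge] linear_diff[OF linear_dx_wedge])
    ultimately have "(\<lambda>n. \<Sum>j\<in>UNIV. tent z r y * ((w j (y + h n *\<^sub>R axis j 1) - w j y) / h n))
        \<longlonglongrightarrow> (\<Sum>j\<in>UNIV. tent z r y * dx_wedge j (D (axis j 1)) $ J)"
      by (intro tendsto_sum tendsto_mult tendsto_const) simp
    then show ?thesis
      by (simp add: S_def \<beta> sum_distrib_left)
  next
    case False
    then show ?thesis by (simp add: S_def tent_eq_0)
  qed
  have int_tw: "integrable lborel (\<lambda>y. tent z r y * w j (y + v))" for j v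
  proof (rule integrable_bounded_on_cube)
    show "\<bar>tent z r y * w j (y + v)\<bar> \<le> r * B" for y
      unfolding abs_mult using r tent_le[of r z y] tent_nonneg[of z r y]
      by (intro mult_mono w_B) auto
    show "tent z r y * w j (y + v) = 0" if "y \<notin> cube z r" for y
      using that by (simp add: tent_eq_0)
  qed simp
  have int_tw0: "integrable lborel (\<lambda>y. tent z r y * w j y)" for j
    using int_tw[of j 0] by simp
  have int_diff: "integrable lborel (\<lambda>y. tent z r y * (w j (y + v) - w j y))" for j v
    using Bochner_Integration.integrable_diff[OF int_tw[of j v] int_tw0[of j]]
    by (simp add: right_diff_distrib)
  have int_u0: "integrable lborel (\<lambda>y. norm (u0 y))"
  proof (rule integrable_bounded_on_cube)
    show "norm (u0 y) = 0" if "y \<notin> cube z R" for y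
      using that by (simp add: u0_def)
    show "\<bar>norm (u0 y)\<bar> \<le> B" for y
      using B by simp
  qed simp
  have S_bound: "\<bar>integral\<^sup>L lborel (S n)\<bar> \<le> CARD('n) * (\<integral>y. norm (u0 y) \<partial>lborel)" for n
  proof -
    have "\<bar>\<integral>y. tent z r y * (w j (y + h n *\<^sub>R axis j 1) - w j y) / h n \<partial>lborel\<bar>
        \<le> (\<integral>y. norm (u0 y) \<partial>lborel)" for j
    proof -
      let ?v = "h n *\<^sub>R axis j (1::real) :: real ^ 'n::{finite,linorder}"
      note p = lborel_integral_difference_by_parts[OF int_tw0[of j] int_tw[of j ?v]]
      have "\<bar>\<integral>y. tent z r y * (w j (y + ?v) - w j y) / h n \<partial>lborel\<bar>
          = \<bar>\<integral>y. (tent z r (y - ?v) - tent z r y) * w j y / h n \<partial>lborel\<bar>"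
        by (simp add: p(1))
      also have "\<dots> \<le> (\<integral>y. \<bar>(tent z r (y - ?v) - tent z r y) * w j y / h n\<bar> \<partial>lborel)"
        by (rule integral_abs_bound)
      also have "\<dots> \<le> (\<integral>y. norm (u0 y) \<partial>lborel)"
      proof (rule integral_mono)
        show "integrable lborel (\<lambda>y. \<bar>(tent z r (y - ?v) - tent z r y) * w j y / h n\<bar>)"
          by (intro integrable_abs integrable_divide p(2))
        fix y
        have "\<bar>tent z r (y - ?v) - tent z r y\<bar> \<le> h n"
          using tent_lipschitz[of z r y "- ?v"] h[of n] by (simp add: norm_axis_1)
        then have "\<bar>(tent z r (y - ?v) - tent z r y) * w j y\<bar> \<le> h n * norm (u0 y)"
          unfolding abs_mult by (intro mult_mono w_le) (use h[of n] in auto)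
        then show "\<bar>(tent z r (y - ?v) - tent z r y) * w j y / h n\<bar> \<le> norm (u0 y)"
          using h[of n] by (simp add: abs_divide field_simps)
      qed (fact int_u0)
      finally show ?thesis .
    qed
    then have "(\<Sum>j\<in>(UNIV::'n set). \<bar>\<integral>y. tent z r y * (w j (y + h n *\<^sub>R axis j 1) - w j y) / h n \<partial>lborel\<bar>)
        \<le> CARD('n) * (\<integral>y. norm (u0 y) \<partial>lborel)"
      by (intro sum_bounded_above) auto
    moreover have "integral\<^sup>L lborel (S n)
        = (\<Sum>j\<in>UNIV. \<integral>y. tent z r y * (w j (y + h n *\<^sub>R axis j 1) - w j y) / h n \<partial>lborel)"
      unfolding S_def
      by (intro Bochner_Integration.integral_sum integrable_divide int_diff)
    ultimately show ?thesis
      by (simp only:) (rule order_trans[OF sum_abs])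
  qed
  have "(\<lambda>n. integral\<^sup>L lborel (S n)) \<longlonglongrightarrow> (\<integral>y. tent z r y * \<beta> y $ J \<partial>lborel)"
  proof (rule integral_dominated_convergence)
    show "integrable lborel (\<lambda>y. CARD('n) * L * tent z r y)"
    proof (rule integrable_bounded_on_cube)
      show "CARD('n) * L * tent z r y = 0" if "y \<notin> cube z r" for y
        using that by (simp add: tent_eq_0)
      show "\<bar>CARD('n) * L * tent z r y\<bar> \<le> \<bar>CARD('n) * L\<bar> * r" for y
        unfolding abs_mult using r tent_le[of r z y] tent_nonneg[of z r y]
        by (intro mult_mono) auto
    qed simp
    show "AE y in lborel. (\<lambda>n. S n y) \<longlonglongrightarrow> tent z r y * \<beta> y $ J"
      using d by eventually_elim (rule S_lim)
    show "S n \<in> borel_measurable lborel" for n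
      unfolding S_def by measurable
    show "AE y in lborel. norm (S n y) \<le> CARD('n) * L * tent z r y" for n
    proof (rule AE_I2)
      fix y
      have "\<bar>tent z r y * (w j (y + h n *\<^sub>R axis j 1) - w j y) / h n\<bar> \<le> L * tent z r y" for j
      proof (cases "y \<in> cube z r")
        case True
        have "\<bar>w j (y + h n *\<^sub>R axis j 1) - w j y\<bar> \<le> norm (u (y + h n *\<^sub>R axis j 1) - u y)"
          using sub[OF True] shift[OF True]
            abs_dx_wedge_nth_le[of j "u (y + h n *\<^sub>R axis j 1) - u y" J]
          by (simp add: w_def u0_def linear_diff[OF linear_dx_wedge])
        also have "\<dots> \<le> L * h n"
          using lipschitz_onD[OF L shift[OF True] sub[OF True], of n j] h(1)[of n]
          by (simp add: dist_norm norm_axis_1)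
        finally have "tent z r y * \<bar>w j (y + h n *\<^sub>R axis j 1) - w j y\<bar> \<le> tent z r y * (L * h n)"
          by (intro mult_left_mono tent_nonneg)
        then show ?thesis
          using h(1)[of n] tent_nonneg[of z r y]
          by (simp add: abs_mult pos_divide_le_eq mult_ac)
      qed (simp add: tent_eq_0)
      then have "(\<Sum>j\<in>UNIV. \<bar>tent z r y * (w j (y + h n *\<^sub>R axis j 1) - w j y) / h n\<bar>)
          \<le> CARD('n) * (L * tent z r y)"
        by (intro sum_bounded_above)
      then show "norm (S n y) \<le> CARD('n) * L * tent z r y"
        unfolding S_def real_norm_def mult.assoc by (rule order_trans[OF sum_abs])
    qed
  qed measurable
  then have "(\<lambda>n. \<bar>integral\<^sup>L lborel (S n)\<bar>) \<longlonglongrightarrow> \<bar>\<integral>y. tent z r y * \<beta> y $ J \<partial>lborel\<bar>"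
    by (rule tendsto_rabs)
  then have "\<bar>\<integral>y. tent z r y * \<beta> y $ J \<partial>lborel\<bar> \<le> CARD('n) * (\<integral>y. norm (u0 y) \<partial>lborel)"
    by (rule LIMSEQ_le_const2) (use S_bound in auto)
  then show ?thesis
    by (simp add: u0_def abs_mult)
qed

section \<open>Scales and strips\<close>

text \<open>
  The exponents \<open>i (i - 1)\<close> and \<open>i\<^sup>2\<close> interleave, so that \<open>len i\<close>, \<open>period i\<close>, \<open>len (i + 1)\<close>
  decrease by the factor \<open>2\<^sup>-\<^sup>i\<close> at each of the two steps.
\<close>

definition len :: "nat \<Rightarrow> real"
  where "len i = (1 / 2) ^ (i * (i - 1))"

definition period :: "nat \<Rightarrow> real"
  where "period i = (1 / 2) ^ (i * i)"

text \<open>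
  The union of the intervals \<open>[k \<rho>, k \<rho> + len (i + 1))\<close>, where \<open>\<rho> = period i\<close> and \<open>k\<close> is an integer;
  their density is \<open>2\<^sup>-\<^sup>i\<close>.
\<close>

definition strip :: "nat \<Rightarrow> real set"
  where "strip i = {t. frac (t / period i) < (1 / 2) ^ i}"

text \<open>
  The last strip that contains \<open>t\<close>: later strips override earlier ones. Points in infinitely many strips
  receive an unspecified level, which is harmless because later strips cover little of any cube.
\<close>

definition level :: "real \<Rightarrow> nat"
  where "level t = (LEAST i. \<forall>j>i. t \<notin> strip j)"

definition half_wavelength :: "real \<Rightarrow> real"
  where "half_wavelength t = len (Suc (level t))"

lemma len_pos: "0 < len i" and len_le_1: "len i \<le> 1"
  by (simp_all add: len_def power_le_one)

lemma period_pos: "0 < period i"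
  by (simp add: period_def)

lemma len_Suc: "len (Suc i) = len i * (1 / 4) ^ i"
proof -
  have "Suc i * (Suc i - 1) = i * (i - 1) + 2 * i"
    by (cases i) (simp_all add: algebra_simps)
  then have "len (Suc i) = len i * (1 / 2) ^ (2 * i)"
    unfolding len_def by (simp only: power_add)
  then show ?thesis
    by (simp add: power_mult power_divide)
qed

lemma len_Suc_period: "len (Suc i) = period i * (1 / 2) ^ i"
proof -
  have "Suc i * (Suc i - 1) = i * i + i"
    by simp
  then show ?thesis
    unfolding len_def period_def by (simp only: power_add)
qed

lemma period_len: "period i = len i * (1 / 2) ^ i"
proof -
  have "i * i = i * (i - 1) + i"
    by (cases i) simp_all
  then show ?thesis
    unfolding len_def period_def by (metis power_add)
qed

lemma level_eqI:
  assumes "t \<in> strip i" "\<And>j. i < j \<Longrightarrow> t \<notin> strip j"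
  shows "level t = i"
  unfolding level_def using assms by (intro Least_equality) (auto simp: not_le[symmetric])

lemma sets_strip [measurable]: "strip i \<in> sets borel"
proof -
  have "(\<lambda>t. frac (t / period i)) \<in> borel_measurable borel"
    unfolding frac_def by measurable
  then have "Measurable.pred borel (\<lambda>t. frac (t / period i) < (1 / 2) ^ i)"
    by measurable
  then show ?thesis
    by (simp add: strip_def pred_def)
qed

lemma borel_measurable_half_wavelength [measurable]: "half_wavelength \<in> borel_measurable borel"
proof -
  have "level \<in> measurable borel (count_space UNIV)"
    unfolding level_def by measurable
  then show ?thesis
    unfolding half_wavelength_def by (rule measurable_compose) simp
qed

lemma half_wavelength_pos: "0 < half_wavelength t" and half_wavelength_le_1: "half_wavelength t \<le> 1"
  by (simp_all add: half_wavelength_def len_pos len_le_1)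

lemma strip_iff: "t \<in> strip i \<longleftrightarrow> t < of_int \<lfloor>t / period i\<rfloor> * period i + len (Suc i)"
  using period_pos[of i]
  by (simp add: strip_def frac_def len_Suc_period field_simps)

lemma sets_cube_strip: "{y \<in> cube z r. y $ q \<in> strip j} \<in> sets borel"
proof -
  have "(\<lambda>y. y $ q) \<in> borel_measurable borel"
    by (intro borel_measurable_continuous_onI continuous_intros)
  from measurable_sets[OF this sets_strip] sets_cube[of z r]
  have "cube z r \<inter> (\<lambda>y. y $ q) -` strip j \<in> sets borel"
    by (intro sets.Int) simp_all
  moreover have "{y \<in> cube z r. y $ q \<in> strip j} = cube z r \<inter> (\<lambda>y. y $ q) -` strip j"
    by auto
  ultimately show ?thesis
    by simp
qed

lemma measure_cube_strip_le:
  fixes z :: "real ^ 'n::finite"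
  assumes r: "0 < r"
  shows "measure lborel {y \<in> cube z r. y $ q \<in> strip j}
    \<le> (2 * r / period j + 2) * (len (Suc j) * (2 * r) ^ (CARD('n) - 1))"
proof -
  let ?\<rho> = "period j" and ?w = "len (Suc j)"
  define a where "a k = (\<chi> i. if i = q then of_int k * ?\<rho> else z $ i - r)" for k :: int
  define b where "b k = (\<chi> i. if i = q then of_int k * ?\<rho> + ?w else z $ i + r)" for k :: int
  let ?K = "{\<lfloor>(z $ q - r) / ?\<rho>\<rfloor>..\<lfloor>(z $ q + r) / ?\<rho>\<rfloor>}"
  have "{y \<in> cube z r. y $ q \<in> strip j} \<subseteq> (\<Union>k\<in>?K. cbox (a k) (b k))"
  proof
    fix y assume y: "y \<in> {y \<in> cube z r. y $ q \<in> strip j}"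
    then have yc: "\<bar>y $ i - z $ i\<bar> \<le> r" for i
      by (simp add: cube_def)
    define k where "k = \<lfloor>y $ q / ?\<rho>\<rfloor>"
    have "z $ q - r \<le> y $ q" "y $ q \<le> z $ q + r"
      using yc[of q] by linarith+
    then have "k \<in> ?K"
      using period_pos[of j] by (auto simp: k_def intro!: floor_mono divide_right_mono)
    moreover have "of_int k * ?\<rho> \<le> y $ q"
      using of_int_floor_le[of "y $ q / ?\<rho>"] period_pos[of j] by (simp only: k_def pos_le_divide_eq)
    moreover have "y $ q \<le> of_int k * ?\<rho> + ?w"
      using y by (simp add: strip_iff k_def less_imp_le)
    ultimately show "y \<in> (\<Union>k\<in>?K. cbox (a k) (b k))"
      using yc by (auto simp: a_def b_def mem_box_cart abs_le_iff algebra_simps intro!: bexI[of _ k])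
  qed
  then have "measure lborel {y \<in> cube z r. y $ q \<in> strip j} \<le> measure lborel (\<Union>k\<in>?K. cbox (a k) (b k))"
    by (intro measure_mono_fmeasurable fmeasurable.finite_UN) auto
  also have "\<dots> \<le> (\<Sum>k\<in>?K. measure lborel (cbox (a k) (b k)))"
    by (intro measure_UNION_le) auto
  also have "\<dots> = (\<Sum>k\<in>?K. ?w * (2 * r) ^ (CARD('n) - 1))"
  proof (intro sum.cong refl)
    fix k
    have le: "a k $ i \<le> b k $ i" for i
      using r len_pos[of "Suc j"] by (simp add: a_def b_def)
    then have "cbox (a k) (b k) \<noteq> {}"
      by (simp add: interval_ne_empty_cart)
    then have "measure lborel (cbox (a k) (b k)) = (\<Prod>i\<in>UNIV. if i = q then ?w else 2 * r)"
      by (simp add: content_cbox_cart a_def b_def if_distrib cong: if_cong)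
    also have "\<dots> = ?w * (\<Prod>i\<in>UNIV - {q}. 2 * r)"
      by (subst prod.remove[of _ q]) auto
    finally show "measure lborel (cbox (a k) (b k)) = ?w * (2 * r) ^ (CARD('n) - 1)"
      by (simp add: card_Diff_singleton)
  qed
  also have "\<dots> = card ?K * (?w * (2 * r) ^ (CARD('n) - 1))"
    by simp
  also have "\<dots> \<le> (2 * r / ?\<rho> + 2) * (?w * (2 * r) ^ (CARD('n) - 1))"
  proof (rule mult_right_mono)
    have "(z $ q + r) / ?\<rho> - (z $ q - r) / ?\<rho> = 2 * r / ?\<rho>"
      by (simp add: diff_divide_distrib add_divide_distrib)
    moreover have "0 < 2 * r / ?\<rho>"
      using r period_pos[of j] by simp
    ultimately show "real (card ?K) \<le> 2 * r / ?\<rho> + 2"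
      by (simp del: of_nat_nat) linarith
    show "0 \<le> ?w * (2 * r) ^ (CARD('n) - 1)"
      using r len_pos[of "Suc j"] by simp
  qed
  finally show ?thesis .
qed

text \<open>
  The densities \<open>2\<^sup>-\<^sup>j\<close> of the strips with \<open>j > i\<close> add up to \<open>2\<^sup>-\<^sup>i\<close>. The factor \<open>2\<close> accounts for the
  intervals that stick out of the cube: at least two periods of such a strip fit into its side.
\<close>

lemma measure_cube_later_strips_le:
  fixes z :: "real ^ 'n::finite"
  assumes i: "1 \<le> i" and r: "r = len (Suc i) / 3"
  shows "measure lborel {y \<in> cube z r. \<exists>j>i. y $ q \<in> strip j} \<le> 2 * (1 / 2) ^ i * (2 * r) ^ CARD('n)"
proof -
  have r0: "0 < r"
    using r len_pos[of "Suc i"] by simp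
  let ?F = "\<lambda>n. {y \<in> cube z r. y $ q \<in> strip (Suc (i + n))}"
  have F: "?F n \<in> sets borel" for n
    by (rule sets_cube_strip)
  have F': "?F n \<in> fmeasurable lborel" for n
  proof (rule fmeasurableI2)
    show "cube z r \<in> fmeasurable lborel"
      unfolding cube_eq_cbox by simp
    show "?F n \<subseteq> cube z r"
      by blast
    show "?F n \<in> sets lborel"
      unfolding sets_lborel by (rule F)
  qed
  have bound: "measure lborel (?F n) \<le> 2 * (1 / 2) ^ Suc (i + n) * (2 * r) ^ CARD('n)" for n
  proof -
    let ?j = "Suc (i + n)"
    have "period ?j \<le> period (Suc i)"
      unfolding period_def by (intro power_decreasing mult_mono) auto
    also have "\<dots> \<le> r"
    proof -
      have "Suc i * Suc i = Suc i * (Suc i - 1) + Suc i"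
        by simp
      then have "period (Suc i) = len (Suc i) * (1 / 2) ^ Suc i"
        unfolding period_def len_def by (simp only: power_add)
      also have "(1 / 2 :: real) ^ Suc i \<le> 1 / 3"
        using power_decreasing[of "Suc (Suc 0)" "Suc i" "1 / 2 :: real"] i by simp
      then have "len (Suc i) * (1 / 2) ^ Suc i \<le> len (Suc i) * (1 / 3)"
        by (rule mult_left_mono[OF _ less_imp_le[OF len_pos]])
      also have "\<dots> = r"
        using r by simp
      finally show ?thesis .
    qed
    finally have "2 \<le> 2 * r / period ?j"
      using period_pos[of ?j] by (simp add: field_simps)
    then have "(2 * r / period ?j + 2) * (len (Suc ?j) * (2 * r) ^ (CARD('n) - 1))
        \<le> (2 * (2 * r / period ?j)) * (len (Suc ?j) * (2 * r) ^ (CARD('n) - 1))"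
      using r0 len_pos[of "Suc ?j"] by (intro mult_right_mono) auto
    also have "\<dots> = 2 * (1 / 2) ^ ?j * (2 * r * (2 * r) ^ (CARD('n) - 1))"
      using period_pos[of ?j] by (simp add: len_Suc_period)
    also have "2 * r * (2 * r) ^ (CARD('n) - 1) = (2 * r) ^ CARD('n)"
      by (subst mult.commute, rule power_minus_mult) simp
    finally show ?thesis
      using measure_cube_strip_le[OF r0, of z q ?j] by linarith
  qed
  have "measure lborel (\<Union>n. ?F n) \<le> 2 * (1 / 2) ^ i * (2 * r) ^ CARD('n)"
  proof (rule measure_countable_Union_le[OF F'])
    fix N
    have "measure lborel (\<Union>n\<le>N. ?F n) \<le> (\<Sum>n\<le>N. measure lborel (?F n))"
      using F by (intro measure_UNION_le) auto
    also have "\<dots> \<le> (\<Sum>n\<le>N. (1 / 2) ^ n * ((1 / 2) ^ i * (2 * r) ^ CARD('n)))"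
      using bound by (intro sum_mono) (simp add: power_add mult_ac)
    also have "\<dots> = (\<Sum>n\<le>N. (1 / 2) ^ n) * ((1 / 2) ^ i * (2 * r) ^ CARD('n))"
      by (simp add: sum_distrib_right)
    also have "(\<Sum>n\<le>N. (1 / 2 :: real) ^ n) \<le> 2"
      unfolding sum_gp0 by simp
    finally show "measure lborel (\<Union>n\<le>N. ?F n) \<le> 2 * (1 / 2) ^ i * (2 * r) ^ CARD('n)"
      using r0 by (simp add: mult_right_mono)
  qed
  moreover have "(\<Union>n. ?F n) = {y \<in> cube z r. \<exists>j>i. y $ q \<in> strip j}"
    by (auto simp: less_iff_Suc_add)
  ultimately show ?thesis
    by simp
qed

section \<open>The oscillating potential\<close>

text \<open>
  A function of class \<open>C\<^sup>1\<close> that vanishes exactly for \<open>t \<le> 0\<close>, from which a cutoff with an explicit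
  derivative is built by composition.
\<close>

definition pos_sq :: "real \<Rightarrow> real"
  where "pos_sq t = (max 0 t)\<^sup>2"

lemma DERIV_pos_sq: "(pos_sq has_real_derivative 2 * max 0 t) (at t)"
proof -
  consider "t < 0" | "t = 0" | "0 < t" by linarith
  then show ?thesis
  proof cases
    case 1
    have "((\<lambda>_. 0) has_real_derivative 2 * max 0 t) (at t)"
      using 1 by simp
    moreover have "eventually (\<lambda>s. s < 0) (nhds t)"
      using 1 by (intro eventually_nhds_in_open[of "{..<0}", simplified]) auto
    then have "eventually (\<lambda>s. 0 = pos_sq s) (nhds t)"
      by eventually_elim (simp add: pos_sq_def)
    ultimately show ?thesis
      by (subst (asm) DERIV_cong_ev[OF refl _ refl]) auto
  next
    case 2
    have "norm (pos_sq s / s) \<le> norm s" for s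
      by (auto simp: pos_sq_def power2_eq_square max_def)
    then have "((\<lambda>s. pos_sq s / s) \<longlongrightarrow> 0) (at 0)"
      by (intro Lim_null_comparison[OF _ tendsto_norm_zero[OF tendsto_ident_at]]) auto
    then show ?thesis
      using 2 by (simp add: DERIV_def pos_sq_def)
  next
    case 3
    have "((\<lambda>s. s\<^sup>2) has_real_derivative 2 * max 0 t) (at t)"
      using 3 by (auto intro!: derivative_eq_intros)
    moreover have "eventually (\<lambda>s. 0 < s) (nhds t)"
      using 3 by (intro eventually_nhds_in_open[of "{0<..}", simplified]) auto
    then have "eventually (\<lambda>s. s\<^sup>2 = pos_sq s) (nhds t)"
      by eventually_elim (simp add: pos_sq_def)
    ultimately show ?thesis
      by (subst (asm) DERIV_cong_ev[OF refl _ refl]) auto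
  qed
qed

lemmas DERIV_pos_sq_chain = DERIV_chain2[OF DERIV_pos_sq]

lemma borel_measurable_pos_sq [measurable]: "pos_sq \<in> borel_measurable borel"
  unfolding pos_sq_def by measurable

definition edge :: "real \<Rightarrow> real"
  where "edge t = pos_sq (t - 3 / 4) + pos_sq (1 / 4 - t)"

definition edge_deriv :: "real \<Rightarrow> real"
  where "edge_deriv t = 2 * max 0 (t - 3 / 4) - 2 * max 0 (1 / 4 - t)"

lemma edge_nonneg: "0 \<le> edge t"
  by (simp add: edge_def pos_sq_def)

lemma
  assumes "\<bar>t - 1 / 2\<bar> \<le> 1 / 4"
  shows edge_eq_0: "edge t = 0" and edge_deriv_eq_0: "edge_deriv t = 0"
proof -
  have "t - 3 / 4 \<le> 0" "1 / 4 - t \<le> 0"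
    using assms by linarith+
  then have "max 0 (t - 3 / 4) = 0" "max 0 (1 / 4 - t) = 0"
    by linarith+
  then show "edge t = 0" "edge_deriv t = 0"
    by (simp_all only: edge_def edge_deriv_def pos_sq_def) simp_all
qed

lemma less_power2_max_0: "0 \<le> a \<Longrightarrow> a < s \<Longrightarrow> a\<^sup>2 < pos_sq s"
  by (simp add: pos_sq_def power_strict_mono)

lemma edge_outside: "t < 0 \<or> 1 < t \<Longrightarrow> 1 / 16 < edge t"
  using less_power2_max_0[of "1 / 4" "t - 3 / 4"] less_power2_max_0[of "1 / 4" "1 / 4 - t"]
  by (auto simp: edge_def power2_eq_square pos_sq_def intro: add_strict_increasing add_strict_increasing2)

lemma abs_edge_deriv_le: "edge t \<le> 1 / 16 \<Longrightarrow> \<bar>edge_deriv t\<bar> \<le> 1"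
proof -
  assume "edge t \<le> 1 / 16"
  then have "\<not> (t < 0 \<or> 1 < t)"
    using edge_outside[of t] by (metis not_le)
  then have "0 \<le> max 0 (t - 3 / 4)" "max 0 (t - 3 / 4) \<le> 1 / 4"
    "0 \<le> max 0 (1 / 4 - t)" "max 0 (1 / 4 - t) \<le> 1 / 4"
    by (auto simp: max_def)
  moreover have "\<bar>2 * u - 2 * v\<bar> \<le> 1" if "0 \<le> u" "u \<le> 1 / 4" "0 \<le> v" "v \<le> 1 / 4" for u v :: real
    using that by linarith
  ultimately show ?thesis
    unfolding edge_deriv_def by blast
qed

lemma DERIV_edge: "(edge has_real_derivative edge_deriv t) (at t)"
  unfolding edge_def edge_deriv_def
  by (auto intro!: derivative_eq_intros DERIV_pos_sq_chain)

text \<open>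
  Outside the unit cube some \<open>edge (x $ j)\<close> exceeds \<open>1 / 16\<close>, so the argument of \<open>pos_sq\<close> is negative; on the
  concentric cube of half the side all of them vanish.
\<close>

definition cutoff :: "real ^ 'n::finite \<Rightarrow> real"
  where "cutoff x = pos_sq (1 - 16 * (\<Sum>j\<in>UNIV. edge (x $ j)))"

definition cutoff_deriv :: "'n \<Rightarrow> real ^ 'n::finite \<Rightarrow> real"
  where "cutoff_deriv i x =
    2 * max 0 (1 - 16 * (\<Sum>j\<in>UNIV. edge (x $ j))) * (- 16 * edge_deriv (x $ i))"

lemma edge_le_sum_edge: "edge (x $ i) \<le> (\<Sum>j\<in>UNIV. edge (x $ j))"
  by (rule member_le_sum) (auto simp: edge_nonneg)

lemma sum_edge_nonneg: "0 \<le> (\<Sum>j\<in>UNIV. edge (x $ j))"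
  by (intro sum_nonneg edge_nonneg)

lemma cutoff_bounds: "0 \<le> cutoff x" "cutoff x \<le> 1"
  using sum_edge_nonneg[of x] by (auto simp: cutoff_def pos_sq_def power_le_one)

lemma abs_cutoff_deriv_le: "\<bar>cutoff_deriv i x\<bar> \<le> 32"
proof (cases "1 - 16 * (\<Sum>j\<in>UNIV. edge (x $ j)) \<le> 0")
  case False
  then have "\<bar>edge_deriv (x $ i)\<bar> \<le> 1"
    using edge_le_sum_edge[of x i] by (intro abs_edge_deriv_le) linarith
  moreover have "\<bar>max 0 (1 - 16 * (\<Sum>j\<in>UNIV. edge (x $ j)))\<bar> \<le> 1"
    using sum_edge_nonneg[of x] by auto
  ultimately have "\<bar>max 0 (1 - 16 * (\<Sum>j\<in>UNIV. edge (x $ j)))\<bar> * \<bar>edge_deriv (x $ i)\<bar> \<le> 1 * 1"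
    by (intro mult_mono) auto
  then show ?thesis
    by (simp add: cutoff_deriv_def abs_mult)
qed (simp add: cutoff_deriv_def)

lemma cutoff_outside_unit_cube:
  assumes "x \<notin> unit_cube"
  shows "cutoff x = 0" "cutoff_deriv i x = 0"
proof -
  obtain j where "x $ j < 0 \<or> 1 < x $ j"
    using assms by (auto simp: unit_cube_def not_le)
  then have "1 - 16 * (\<Sum>j\<in>UNIV. edge (x $ j)) \<le> 0"
    using edge_outside[of "x $ j"] edge_le_sum_edge[of x j] by linarith
  then show "cutoff x = 0" "cutoff_deriv i x = 0"
    by (simp_all add: cutoff_def cutoff_deriv_def pos_sq_def)
qed

abbreviation centre :: "real ^ 'n::finite"
  where "centre \<equiv> \<chi> i. 1 / 2"

lemma cutoff_core:
  assumes "x \<in> cube centre (1 / 4)"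
  shows "cutoff x = 1" "cutoff_deriv i x = 0"
  using assms
  by (auto simp: cutoff_def cutoff_deriv_def cube_def edge_eq_0 edge_deriv_eq_0 pos_sq_def)

lemma has_partial_derivative_cutoff: "has_partial_derivative i cutoff (cutoff_deriv i)"
  unfolding has_partial_derivative_def
proof
  fix x :: "real ^ 'a"
  have "((\<lambda>t. edge ((x + t *\<^sub>R axis i 1) $ j)) has_real_derivative
      (if j = i then edge_deriv (x $ i) else 0)) (at 0)" for j
  proof (cases "j = i")
    case True
    have "((\<lambda>t. edge (x $ i + t)) has_real_derivative edge_deriv (x $ i + 0) * 1) (at 0)"
      by (rule DERIV_chain2[OF DERIV_edge]) (auto intro!: derivative_eq_intros)
    then show ?thesis
      using True by simp
  next
    case False
    then show ?thesis by (simp add: axis_def)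
  qed
  then have "((\<lambda>t. \<Sum>j\<in>UNIV. edge ((x + t *\<^sub>R axis i 1) $ j)) has_real_derivative
      (\<Sum>j\<in>UNIV. if j = i then edge_deriv (x $ i) else 0)) (at 0)"
    by (rule DERIV_sum)
  then have "((\<lambda>t. \<Sum>j\<in>UNIV. edge ((x + t *\<^sub>R axis i 1) $ j)) has_real_derivative
      edge_deriv (x $ i)) (at 0)"
    by simp
  from DERIV_diff[OF DERIV_const[of 1] DERIV_cmult[OF this, of 16]]
  have "((\<lambda>t. 1 - 16 * (\<Sum>j\<in>UNIV. edge ((x + t *\<^sub>R axis i 1) $ j))) has_real_derivative
      - 16 * edge_deriv (x $ i)) (at 0)"
    by (simp only: diff_0 minus_mult_left)
  from DERIV_pos_sq_chain[OF this]
  show "((\<lambda>t. cutoff (x + t *\<^sub>R axis i 1)) has_real_derivative cutoff_deriv i x) (at 0)"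
    by (simp add: cutoff_def cutoff_deriv_def)
qed

lemma borel_measurable_edge [measurable]:
  "edge \<in> borel_measurable borel" "edge_deriv \<in> borel_measurable borel"
  unfolding edge_def edge_deriv_def by measurable

lemma borel_measurable_cutoff [measurable]:
  "cutoff \<in> borel_measurable borel" "cutoff_deriv i \<in> borel_measurable borel"
  unfolding cutoff_def cutoff_deriv_def by measurable

text \<open>
  The amplitude is proportional to the half-wavelength, so that the derivative in direction \<open>p\<close> is a cosine of
  amplitude \<open>1\<close> whatever the half-wavelength.
\<close>

definition wave :: "'n \<Rightarrow> 'n \<Rightarrow> real ^ 'n::finite \<Rightarrow> real"
  where "wave p q x = half_wavelength (x $ q) / pi * sin (pi * x $ p / half_wavelength (x $ q))"

definition potential :: "'n \<Rightarrow> 'n \<Rightarrow> real ^ 'n::finite \<Rightarrow> real"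
  where "potential p q x = wave p q x * cutoff x"

text \<open>
  The derivative of the potential in direction \<open>j\<close> for \<open>j \<noteq> q\<close>.
\<close>

definition potential_deriv :: "'n \<Rightarrow> 'n \<Rightarrow> 'n \<Rightarrow> real ^ 'n::finite \<Rightarrow> real"
  where "potential_deriv p q j x =
    (if j = p then cos (pi * x $ p / half_wavelength (x $ q)) * cutoff x else 0) + wave p q x * cutoff_deriv j x"

lemma borel_measurable_wave [measurable]: "wave p q \<in> borel_measurable borel"
  unfolding wave_def by measurable

lemma borel_measurable_potential [measurable]: "potential p q \<in> borel_measurable borel"
  unfolding potential_def by measurable

lemma borel_measurable_potential_deriv [measurable]: "potential_deriv p q j \<in> borel_measurable borel"
  unfolding potential_deriv_def by measurable

lemma abs_wave_le: "\<bar>wave p q x\<bar> \<le> 1"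
proof -
  have "half_wavelength (x $ q) / pi \<le> 1"
    using half_wavelength_le_1[of "x $ q"] pi_ge_two by simp
  then have "\<bar>half_wavelength (x $ q) / pi\<bar> * \<bar>sin (pi * x $ p / half_wavelength (x $ q))\<bar> \<le> 1 * 1"
    using half_wavelength_pos[of "x $ q"] by (intro mult_mono) (auto simp: less_imp_le)
  then show ?thesis
    by (simp add: wave_def abs_mult)
qed

lemma abs_potential_le: "\<bar>potential p q x\<bar> \<le> 1"
  using mult_mono[OF abs_wave_le[of p q x], of "cutoff x" 1] cutoff_bounds[of x]
  by (simp add: potential_def abs_mult)

lemma abs_potential_deriv_le: "\<bar>potential_deriv p q j x\<bar> \<le> 33"
proof -
  have "\<bar>wave p q x * cutoff_deriv j x\<bar> \<le> 1 * 32"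
    unfolding abs_mult by (intro mult_mono abs_wave_le abs_cutoff_deriv_le) auto
  moreover have "\<bar>cos (pi * x $ p / half_wavelength (x $ q)) * cutoff x\<bar> \<le> 1 * 1"
    unfolding abs_mult using cutoff_bounds[of x] by (intro mult_mono) auto
  ultimately show ?thesis
    unfolding potential_deriv_def by (auto split: if_splits)
qed

lemma has_partial_derivative_potential:
  assumes "j \<noteq> q"
  shows "has_partial_derivative j (potential p q) (potential_deriv p q j)"
  unfolding has_partial_derivative_def
proof
  fix x :: "real ^ 'a"
  have q: "(x + t *\<^sub>R axis j 1) $ q = x $ q" for t
    using assms by (simp add: axis_def)
  let ?b = "half_wavelength (x $ q)"
  have b: "?b \<noteq> 0"
    using half_wavelength_pos[of "x $ q"] by simp
  have "((\<lambda>t. wave p q (x + t *\<^sub>R axis j 1)) has_real_derivative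
      (if j = p then cos (pi * x $ p / ?b) else 0)) (at 0)"
  proof (cases "j = p")
    case True
    have "((\<lambda>t. ?b / pi * sin (pi * (x $ p + t) / ?b)) has_real_derivative
        cos (pi * x $ p / ?b)) (at 0)"
      using b by (auto intro!: derivative_eq_intros)
    moreover have "wave p q (x + t *\<^sub>R axis j 1) = ?b / pi * sin (pi * (x $ p + t) / ?b)" for t
      unfolding wave_def q using True by simp
    ultimately show ?thesis
      using True by (simp only: if_True refl)
  next
    case False
    then have "wave p q (x + t *\<^sub>R axis j 1) = wave p q x" for t
      unfolding wave_def q by (simp add: axis_def)
    then show ?thesis
      using False by simp
  qed
  moreover have "((\<lambda>t. cutoff (x + t *\<^sub>R axis j 1)) has_real_derivative cutoff_deriv j x) (at 0)"
    using has_partial_derivative_cutoff[of j] unfolding has_partial_derivative_def by (rule spec)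
  ultimately show "((\<lambda>t. potential p q (x + t *\<^sub>R axis j 1)) has_real_derivative
      potential_deriv p q j x) (at 0)"
    unfolding potential_def potential_deriv_def
    by (auto intro!: derivative_eq_intros)
qed

lemma potential_form_nth:
  assumes "p \<notin> I"
  shows "potential_form I g x $ insert p I = (-1) ^ card {l \<in> insert p I. l < p} * g p x"
proof -
  have zero: "(g j x *\<^sub>R dx_wedge j (axis I 1)) $ insert p I = 0" if "j \<noteq> p" "j \<notin> I" for j
    using that by (simp add: dx_wedge_nth)
  have "potential_form I g x $ insert p I = (\<Sum>j\<in>-I. (g j x *\<^sub>R dx_wedge j (axis I 1)) $ insert p I)"
    by (simp only: potential_form_def sum_component)
  also have "\<dots> = (\<Sum>j\<in>{p}. (g j x *\<^sub>R dx_wedge j (axis I 1)) $ insert p I)"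
  proof (rule sum.mono_neutral_right)
    show "\<forall>j\<in>-I - {p}. (g j x *\<^sub>R dx_wedge j (axis I 1)) $ insert p I = 0"
      using zero by blast
  qed (use assms in auto)
  finally show ?thesis
    using assms by (simp add: dx_wedge_nth)
qed

section \<open>Slopes of a Lipschitz primitive grow\<close>

text \<open>
  Pythagoras: for vectors with mean near \<open>v\<close>, the mean of the squared norms is the squared norm of \<open>v\<close>
  plus the mean square deviation, up to the drift. The gain \<open>c\<close> is the mean square deviation
  itself, not divided by \<open>N\<close>.
\<close>

lemma exists_longer_increment:
  fixes q :: "nat \<Rightarrow> 'a::real_inner"
  assumes N: "0 < N"
    and var: "real N * c \<le> (\<Sum>n<N. (norm (q n - v))\<^sup>2)"
    and drift: "norm ((\<Sum>n<N. q n) - real N *\<^sub>R v) \<le> real N * e"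
    and v: "norm v \<le> B"
  shows "\<exists>n<N. (norm v)\<^sup>2 + c - 2 * B * e \<le> (norm (q n))\<^sup>2"
proof (rule ccontr)
  assume "\<not> ?thesis"
  then have "(\<Sum>n<N. (norm (q n))\<^sup>2) < of_nat (card {..<N}) * ((norm v)\<^sup>2 + c - 2 * B * e)"
    using N by (intro sum_bounded_above_strict) (auto simp: not_le)
  then have lt: "(\<Sum>n<N. (norm (q n))\<^sup>2) < real N * ((norm v)\<^sup>2 + c - 2 * B * e)"
    by simp
  have "(norm (q n))\<^sup>2 = (norm (q n - v))\<^sup>2 + 2 * (v \<bullet> (q n - v)) + (norm v)\<^sup>2" for n
    by (simp add: power2_norm_eq_inner inner_diff inner_commute)
  then have "(\<Sum>n<N. (norm (q n))\<^sup>2)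
      = (\<Sum>n<N. (norm (q n - v))\<^sup>2) + 2 * (\<Sum>n<N. v \<bullet> (q n - v)) + real N * (norm v)\<^sup>2"
    by (simp add: sum.distrib sum_distrib_left)
  also have "(\<Sum>n<N. v \<bullet> (q n - v)) = v \<bullet> ((\<Sum>n<N. q n) - real N *\<^sub>R v)"
    by (simp add: inner_diff_right inner_sum_right sum_subtractf)
  finally have eq: "(\<Sum>n<N. (norm (q n))\<^sup>2) = (\<Sum>n<N. (norm (q n - v))\<^sup>2)
      + 2 * (v \<bullet> ((\<Sum>n<N. q n) - real N *\<^sub>R v)) + real N * (norm v)\<^sup>2" .
  have "\<bar>v \<bullet> ((\<Sum>n<N. q n) - real N *\<^sub>R v)\<bar> \<le> norm v * norm ((\<Sum>n<N. q n) - real N *\<^sub>R v)"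
    by (rule Cauchy_Schwarz_ineq2)
  also have "\<dots> \<le> B * (real N * e)"
    using v drift by (intro mult_mono) (auto intro: order_trans[OF norm_ge_zero])
  finally have "- (B * (real N * e)) \<le> v \<bullet> ((\<Sum>n<N. q n) - real N *\<^sub>R v)"
    by linarith
  then have "real N * c - 2 * (B * (real N * e)) + real N * (norm v)\<^sup>2 \<le> (\<Sum>n<N. (norm (q n))\<^sup>2)"
    using var eq by linarith
  then show False
    using lt by (simp add: algebra_simps)
qed

lemma cos_add_nat_pi: "cos (x + real n * pi) = (-1) ^ n * cos x"
  by (simp add: cos_add cos_npi sin_npi)

lemma cos_ge_half_near_even:
  assumes b: "0 < b" and t: "\<bar>t - 2 * b * of_int m\<bar> \<le> b / 3"
  shows "1 / 2 \<le> cos (pi * t / b)"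
proof -
  define s where "s = pi * (t - 2 * b * of_int m) / b"
  have "pi * t / b = s + 2 * pi * of_int m"
    using b by (simp add: s_def field_simps)
  then have "cos (pi * t / b) = cos s"
    by (simp only: cos_add cos_int_2pin sin_int_2pin)
  also have "\<dots> = cos \<bar>s\<bar>"
    by simp
  also have "cos (pi / 3) \<le> cos \<bar>s\<bar>"
  proof (rule cos_monotone_0_pi_le)
    have "\<bar>s\<bar> = pi * \<bar>t - 2 * b * of_int m\<bar> / b"
      using b by (simp add: s_def abs_mult)
    also have "\<dots> \<le> pi * (b / 3) / b"
      using b t by (intro divide_right_mono mult_left_mono) auto
    finally show "\<bar>s\<bar> \<le> pi / 3"
      using b by simp
  qed auto
  finally show ?thesis
    by (simp add: cos_60)
qed

text \<open>
  The lower bound, relative to the length of a piece, for the mean distance between the increments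
  of \<open>\<omega>\<close> over the pieces and the mean increment; \<open>D\<close> is the dimension.
\<close>

definition growth :: "nat \<Rightarrow> real"
  where "growth D = 1 / (8 * real D * 3 ^ (D + 1))"

text \<open>
  The assumptions of the indirect proof; they turn out to be inconsistent.
\<close>

locale lipschitz_primitive =
  fixes p q :: "'n::{finite,linorder}" and I :: "'n set"
    and \<omega> :: "real ^ 'n::{finite,linorder} \<Rightarrow> real ^ ('n set)" and L :: real
  assumes p: "p \<notin> I" and q: "q \<in> I"
    and lipschitz: "L-lipschitz_on unit_cube \<omega>"
    and primitive: "AE x in lborel. x \<in> unit_cube \<longrightarrow>
      has_exterior_derivative_at \<omega> (potential_form I (potential_deriv p q) x) x"
begin

abbreviation e :: "real ^ 'n::{finite,linorder}"
  where "e \<equiv> axis p 1"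

abbreviation \<eta> :: "real ^ 'n::{finite,linorder} \<Rightarrow> real ^ ('n set)"
  where "\<eta> \<equiv> potential_form I (potential_deriv p q)"

abbreviation core :: "(real ^ 'n::{finite,linorder}) set"
  where "core \<equiv> cube centre (1 / 4)"

lemma core_subset: "core \<subseteq> unit_cube"
proof
  fix x :: "real ^ 'n::{finite,linorder}" assume "x \<in> core"
  then have x: "\<bar>x $ i - 1 / 2\<bar> \<le> 1 / 4" for i
    by (simp add: cube_def)
  have "0 \<le> x $ i \<and> x $ i \<le> 1" for i
    using x[of i] by (intro conjI) linarith+
  then show "x \<in> unit_cube"
    by (simp add: unit_cube_def)
qed

lemma L_nonneg: "0 \<le> L"
  using lipschitz by (rule lipschitz_on_nonneg)

lemma \<omega>_lipschitz: "x \<in> core \<Longrightarrow> y \<in> core \<Longrightarrow> norm (\<omega> x - \<omega> y) \<le> L * norm (x - y)"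
  using lipschitz_onD[OF lipschitz, of x y] core_subset by (auto simp: dist_norm)

lemma \<eta>_core:
  assumes "x \<in> core"
  shows "\<eta> x $ insert p I = (-1) ^ card {l \<in> insert p I. l < p} * cos (pi * x $ p / half_wavelength (x $ q))"
  using cutoff_core[OF assms] by (simp add: potential_form_nth[OF p] potential_deriv_def)

lemma borel_measurable_\<eta> [measurable]: "\<eta> \<in> borel_measurable borel"
  unfolding potential_form_def by measurable

lemma translate_q: "(y + t *\<^sub>R e) $ q = y $ q" and translate_p: "(y + t *\<^sub>R e) $ p = y $ p + t"
  using p q by (auto simp: axis_def)

text \<open>
  The difference of two translates of \<open>\<omega>\<close> by consecutive multiples of the half-wavelength \<open>b\<close> has the exterior
  derivative \<open>\<beta>\<close>, the corresponding difference of \<open>\<eta>\<close>. Since the cosine changes its sign under translation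
  by \<open>b\<close>, the coefficient of \<open>\<beta>\<close> has a fixed sign and absolute value at least \<open>1\<close> on the cube of half-side \<open>b / 3\<close>, except
  on the small set where a later strip interferes. Testing with a tent function shows that the difference is not close
  in mean to any constant \<open>a\<close>.
\<close>

lemma oscillation_forces_bending:
  fixes z :: "real ^ 'n::{finite,linorder}" and n i :: nat and m :: int
  defines "b \<equiv> len (Suc i)"
  assumes i: "1 \<le> i" "24 * 2 ^ CARD('n) * (1 / 2) ^ i \<le> (1 :: real)"
    and zp: "z $ p = 2 * b * of_int m" and zq: "\<And>y. \<bar>y - z $ q\<bar> \<le> b / 3 \<Longrightarrow> y \<in> strip i"
    and core: "\<And>y. y \<in> cube z (b / 2) \<Longrightarrow> y + (real n * b) *\<^sub>R e \<in> core"
      "\<And>y. y \<in> cube z (b / 2) \<Longrightarrow> y + (real (Suc n) * b) *\<^sub>R e \<in> core"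
  shows "(b / 3) ^ (CARD('n) + 1) / 4 \<le> CARD('n) * (\<integral>y. indicator (cube z (b / 2)) y *
    norm (\<omega> (y + (real (Suc n) * b) *\<^sub>R e) - \<omega> (y + (real n * b) *\<^sub>R e) - a) \<partial>lborel)"
proof -
  let ?D = "CARD('n)" and ?J = "insert p I"
  define r where "r = b / 3"
  have b0: "0 < b"
    unfolding b_def by (rule len_pos)
  then have r0: "0 < r" "r < b / 2"
    by (simp_all add: r_def)
  define s where "s k = (real k * b) *\<^sub>R e" for k
  define u where "u y = \<omega> (y + s (Suc n)) - \<omega> (y + s n) - a" for y
  define \<beta> where "\<beta> y = \<eta> (y + s (Suc n)) - \<eta> (y + s n)" for y
  have s_core: "y + s n \<in> core" "y + s (Suc n) \<in> core" if "y \<in> cube z (b / 2)" for y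
    using core that by (simp_all add: s_def)
  have \<beta>_meas [measurable]: "\<beta> \<in> borel_measurable borel"
    unfolding \<beta>_def by measurable
  have "(2 * L)-lipschitz_on (cube z (b / 2)) u"
  proof (rule lipschitz_onI)
    fix x y assume xy: "x \<in> cube z (b / 2)" "y \<in> cube z (b / 2)"
    have "u x - u y = (\<omega> (x + s (Suc n)) - \<omega> (y + s (Suc n))) - (\<omega> (x + s n) - \<omega> (y + s n))"
      by (simp add: u_def)
    then have "norm (u x - u y)
        \<le> norm (\<omega> (x + s (Suc n)) - \<omega> (y + s (Suc n))) + norm (\<omega> (x + s n) - \<omega> (y + s n))"
      by (simp only: norm_triangle_ineq4)
    also have "\<dots> \<le> L * norm (x + s (Suc n) - (y + s (Suc n))) + L * norm (x + s n - (y + s n))"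
      using xy by (intro add_mono \<omega>_lipschitz s_core)
    finally show "dist (u x) (u y) \<le> 2 * L * dist x y"
      by (simp add: dist_norm)
  qed (use L_nonneg in simp)
  moreover have "AE y in lborel. y \<in> cube z r \<longrightarrow> has_exterior_derivative_at u (\<beta> y) y"
    using AE_lborel_translate[OF primitive, of "s n"] AE_lborel_translate[OF primitive, of "s (Suc n)"]
  proof eventually_elim
    case (elim y)
    show ?case
    proof
      assume "y \<in> cube z r"
      then have "y \<in> cube z (b / 2)"
        using cube_mono[of r "b / 2" z] r0 by auto
      then have "y + s n \<in> unit_cube" "y + s (Suc n) \<in> unit_cube"
        using s_core core_subset by blast+
      then have "has_exterior_derivative_at \<omega> (\<eta> (y + s n)) (y + s n)"
        "has_exterior_derivative_at \<omega> (\<eta> (y + s (Suc n))) (y + s (Suc n))"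
        using elim by (simp_all only: add.commute[of _ y])
      then show "has_exterior_derivative_at u (\<beta> y) y"
        unfolding u_def \<beta>_def
        by (intro has_exterior_derivative_at_diff has_exterior_derivative_at_translate)
    qed
  qed
  ultimately have upper: "\<bar>\<integral>y. tent z r y * \<beta> y $ ?J \<partial>lborel\<bar>
      \<le> ?D * (\<integral>y. indicator (cube z (b / 2)) y * norm (u y) \<partial>lborel)"
    by (intro exterior_derivative_tested[OF r0]) auto

  \<comment> \<open>the sign of \<open>\<beta> y $ ?J\<close> on the good part of the cube\<close>
  define \<tau> :: real where "\<tau> = (-1) ^ card {l \<in> ?J. l < p} * (-1) ^ Suc n"
  have \<tau>: "\<bar>\<tau>\<bar> = 1"
    by (simp add: \<tau>_def abs_mult power_abs)
  define Bad where "Bad = {y \<in> cube z r. \<exists>j>i. y $ q \<in> strip j}"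
  have \<beta>_le: "\<bar>\<beta> y $ ?J\<bar> \<le> 2" if "y \<in> cube z r" for y
  proof -
    have "y \<in> cube z (b / 2)"
      using that cube_mono[of r "b / 2" z] r0 by auto
    then have "\<bar>\<eta> (y + s n) $ ?J\<bar> \<le> 1" "\<bar>\<eta> (y + s (Suc n)) $ ?J\<bar> \<le> 1"
      using s_core by (simp_all add: \<eta>_core abs_mult power_abs)
    then show ?thesis
      unfolding \<beta>_def vector_minus_component by linarith
  qed
  have good: "1 \<le> \<tau> * \<beta> y $ ?J" if "y \<in> cube z r" "y \<notin> Bad" for y
  proof -
    have y: "\<bar>y $ j - z $ j\<bar> \<le> b / 3" for j
      using that(1) by (simp add: cube_def r_def)
    have "level (y $ q) = i"
      using that zq[OF y[of q]] by (intro level_eqI) (auto simp: Bad_def)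
    then have wl: "half_wavelength (y $ q) = b"
      by (simp add: half_wavelength_def b_def)
    have cosk: "cos (pi * (y + s k) $ p / half_wavelength ((y + s k) $ q)) = (-1) ^ k * cos (pi * y $ p / b)" for k
    proof -
      have "pi * (y + s k) $ p / half_wavelength ((y + s k) $ q) = pi * y $ p / b + real k * pi"
        using b0 by (simp add: s_def translate_p translate_q wl field_simps del: vector_add_component)
      then show ?thesis
        by (simp only: cos_add_nat_pi)
    qed
    have "y \<in> cube z (b / 2)"
      using that cube_mono[of r "b / 2" z] r0 by auto
    from s_core[OF this]
    have "\<beta> y $ ?J = (-1) ^ card {l \<in> ?J. l < p} * ((-1) ^ Suc n * cos (pi * y $ p / b) - (-1) ^ n * cos (pi * y $ p / b))"
      by (simp only: \<beta>_def vector_minus_component \<eta>_core cosk right_diff_distrib)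
    also have "\<dots> = \<tau> * (2 * cos (pi * y $ p / b))"
      by (simp add: \<tau>_def)
    finally have "\<tau> * \<beta> y $ ?J = \<tau> * \<tau> * (2 * cos (pi * y $ p / b))"
      by simp
    also have "\<tau> * \<tau> = 1"
      using abs_mult_self_eq[of \<tau>] by (simp only: \<tau> mult_1)
    finally show ?thesis
      using cos_ge_half_near_even[OF b0, of "y $ p" m] y[of p] zp by simp
  qed
  have Bad_meas: "Bad \<in> sets borel"
  proof -
    have "Bad = (\<Union>j\<in>{i<..}. {y \<in> cube z r. y $ q \<in> strip j})"
      by (auto simp: Bad_def)
    also have "\<dots> \<in> sets borel"
      by (intro sets.countable_UN' sets_cube_strip) auto
    finally show ?thesis .
  qed
  have Bad_fin: "Bad \<in> fmeasurable lborel"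
  proof (rule fmeasurableI2)
    show "cube z r \<in> fmeasurable lborel"
      unfolding cube_eq_cbox by simp
    show "Bad \<subseteq> cube z r" "Bad \<in> sets lborel"
      using Bad_meas by (auto simp: Bad_def)
  qed
  have half_fin: "cube z (r / 2) \<in> fmeasurable lborel"
    unfolding cube_eq_cbox by simp
  \<comment> \<open>a lower bound of the integrand: off \<open>Bad\<close> it is at least \<open>r / 2\<close> on the inner cube, on \<open>Bad\<close> it is at least \<open>- 2 r\<close>\<close>
  let ?f = "\<lambda>y. indicator (cube z (r / 2)) y * (r / 2) - 3 * r * indicator Bad y"
  have int_f: "integrable lborel (\<lambda>y. indicator (cube z (r / 2)) y * (r / 2))"
    "integrable lborel (\<lambda>y. 3 * r * indicator Bad y)"
    using half_fin Bad_fin by (auto simp: fmeasurable_def intro!: integrable_mult_left integrable_mult_right integrable_real_indicator)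
  have "(\<integral>y. ?f y \<partial>lborel) \<le> (\<integral>y. tent z r y * (\<tau> * \<beta> y $ ?J) \<partial>lborel)"
  proof (rule integral_mono)
    show "integrable lborel ?f"
      using int_f by (rule Bochner_Integration.integrable_diff)
    show "integrable lborel (\<lambda>y. tent z r y * (\<tau> * \<beta> y $ ?J))"
    proof (rule integrable_bounded_on_cube)
      show "tent z r y * (\<tau> * \<beta> y $ ?J) = 0" if "y \<notin> cube z r" for y
        using that by (simp add: tent_eq_0)
      show "\<bar>tent z r y * (\<tau> * \<beta> y $ ?J)\<bar> \<le> r * (1 * 2)" if "y \<in> cube z r" for y
        unfolding abs_mult \<tau> using r0 tent_nonneg[of z r y] tent_le[of r z y] \<beta>_le[OF that]
        by (intro mult_mono) auto
    qed measurable
    fix y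
    show "?f y \<le> tent z r y * (\<tau> * \<beta> y $ ?J)"
    proof (cases "y \<in> cube z r")
      case True
      have half: "indicator (cube z (r / 2)) y * (r / 2) \<le> tent z r y"
        using tent_nonneg[of z r y] by (auto simp: indicator_def tent_def mem_cube_iff_infnorm max_def)
      show ?thesis
      proof (cases "y \<in> Bad")
        case True
        have "\<bar>tent z r y * (\<tau> * \<beta> y $ ?J)\<bar> \<le> r * (1 * 2)"
          unfolding abs_mult \<tau> using r0 tent_nonneg[of z r y] tent_le[of r z y] \<beta>_le[OF \<open>y \<in> cube z r\<close>]
          by (intro mult_mono) auto
        moreover have "indicator (cube z (r / 2)) y * (r / 2) \<le> r"
          using r0 by (auto simp: indicator_def)
        ultimately show ?thesis
          using True by simp
      next
        case False
        have "tent z r y * 1 \<le> tent z r y * (\<tau> * \<beta> y $ ?J)"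
          by (rule mult_left_mono[OF good[OF \<open>y \<in> cube z r\<close> False] tent_nonneg])
        then show ?thesis
          using half False by simp
      qed
    next
      case False
      then have "y \<notin> cube z (r / 2)" "y \<notin> Bad"
        using cube_mono[of "r / 2" r z] r0 by (auto simp: Bad_def)
      then show ?thesis
        using False by (simp add: tent_eq_0)
    qed
  qed
  also have "\<dots> = \<tau> * (\<integral>y. tent z r y * \<beta> y $ ?J \<partial>lborel)"
    by (simp add: mult.left_commute)
  also have "\<dots> \<le> \<bar>\<integral>y. tent z r y * \<beta> y $ ?J \<partial>lborel\<bar>"
    using abs_ge_self[of "\<tau> * (\<integral>y. tent z r y * \<beta> y $ ?J \<partial>lborel)"] by (simp only: abs_mult \<tau> mult_1)
  finally have lower: "(\<integral>y. ?f y \<partial>lborel) \<le> \<bar>\<integral>y. tent z r y * \<beta> y $ ?J \<partial>lborel\<bar>" .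
  have "(\<integral>y. ?f y \<partial>lborel) = measure lborel (cube z (r / 2)) * (r / 2) - 3 * r * measure lborel Bad"
    using int_f by (simp add: Bochner_Integration.integral_diff)
  also have "measure lborel (cube z (r / 2)) = r ^ ?D"
    using r0 by (simp add: measure_cube)
  also have "r ^ ?D * (r / 2) - 3 * r * measure lborel Bad \<ge> r ^ (?D + 1) / 4"
  proof -
    have "measure lborel Bad \<le> 2 * (1 / 2) ^ i * (2 * r) ^ ?D"
      unfolding Bad_def by (rule measure_cube_later_strips_le[OF i(1)]) (simp add: r_def b_def)
    also have "\<dots> = 24 * 2 ^ ?D * (1 / 2) ^ i * (r ^ ?D / 12)"
      by (simp add: power_mult_distrib)
    also have "\<dots> \<le> 1 * (r ^ ?D / 12)"
      using r0 by (intro mult_right_mono i) auto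
    finally have "3 * r * measure lborel Bad \<le> 3 * r * (r ^ ?D / 12)"
      using r0 by (intro mult_left_mono) auto
    then show ?thesis
      by simp
  qed
  finally have "r ^ (?D + 1) / 4 \<le> (\<integral>y. ?f y \<partial>lborel)" .
  with lower upper show ?thesis
    by (simp only: u_def r_def s_def)
qed

abbreviation slope :: "nat \<Rightarrow> real ^ 'n::{finite,linorder} \<Rightarrow> real"
  where "slope i x \<equiv> norm (\<omega> (x + len i *\<^sub>R e) - \<omega> x) / len i"

text \<open>
  The cubes of side \<open>b\<close> are centred along a segment parallel to the given one, which runs along the middle of a
  component of \<open>strip i\<close> and starts at an even multiple of \<open>b\<close>, where the cosine is \<open>1\<close>. The distance between
  the two segments is of order \<open>2\<^sup>-\<^sup>i\<close> relative to the length, and the hypotheses make its effect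
  negligible against the gain. The radii \<open>1 / 8 - 8 * len i\<close> keep all
  segments in the region where the cutoff is \<open>1\<close>.
\<close>

lemma slope_grows:
  fixes x :: "real ^ 'n::{finite,linorder}"
  defines "c \<equiv> growth CARD('n)"
  assumes i: "1 \<le> i" "24 * 2 ^ CARD('n) * (1 / 2) ^ i \<le> (1 :: real)"
      "8 * L\<^sup>2 * CARD('n) * (1 / 2) ^ i \<le> c\<^sup>2 / 2"
    and x: "x \<in> cube centre (1 / 8 - 8 * len i)"
  shows "\<exists>x' \<in> cube centre (1 / 8 - 8 * len (Suc i)). (slope i x)\<^sup>2 + c\<^sup>2 / 2 \<le> (slope (Suc i) x')\<^sup>2"
proof -
  let ?D = "CARD('n)"
  define b where "b = len (Suc i)"
  define \<rho> where "\<rho> = period i"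
  define N :: nat where "N = 4 ^ i"
  have pos: "0 < b" "0 < \<rho>" "0 < len i" "0 < N"
    by (simp_all add: b_def \<rho>_def N_def len_pos period_pos)
  have D0: "0 < real ?D"
    by simp
  have c0: "0 < c"
    by (simp add: c_def growth_def)
  have half: "(1 / 2 :: real) ^ i \<le> 1 / 2"
    using power_decreasing[of 1 i "1 / 2 :: real"] i(1) by simp
  have Nb: "real N * b = len i"
    by (simp add: N_def b_def len_Suc power_divide)
  have \<rho>_len: "\<rho> = len i * (1 / 2) ^ i"
    by (simp add: \<rho>_def period_len)
  have "b = \<rho> * (1 / 2) ^ i"
    by (simp add: b_def \<rho>_def len_Suc_period)
  then have b_\<rho>: "2 * b \<le> \<rho>"
    using mult_left_mono[OF half, of \<rho>] pos by simp
  have \<rho>_len_le: "2 * \<rho> \<le> len i"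
    using mult_left_mono[OF half, of "len i"] pos by (simp add: \<rho>_len)

  define z :: "real ^ 'n::{finite,linorder}" where "z = (\<chi> j.
    if j = p then 2 * b * of_int \<lfloor>x $ p / (2 * b)\<rfloor>
    else if j = q then of_int \<lfloor>x $ q / \<rho>\<rfloor> * \<rho> + b / 2 else x $ j)"
  have z_x: "\<bar>z $ j - x $ j\<bar> \<le> \<rho>" for j
  proof -
    have round: "of_int \<lfloor>t / h\<rfloor> * h \<le> t" "t \<le> of_int \<lfloor>t / h\<rfloor> * h + h" if "0 < h" for t h :: real
      using that of_int_floor_le[of "t / h"] real_of_int_floor_add_one_ge[of "t / h"]
      by (simp_all only: pos_le_divide_eq pos_divide_le_eq distrib_right mult_1)
    consider "j = p" | "j = q" "j \<noteq> p" | "j \<noteq> p" "j \<noteq> q" by blast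
    then show ?thesis
    proof cases
      case 1
      then have "z $ j = of_int \<lfloor>x $ p / (2 * b)\<rfloor> * (2 * b)"
        by (simp add: z_def)
      moreover have "0 < 2 * b"
        using pos by simp
      ultimately show ?thesis
        using round[of "2 * b" "x $ p"] b_\<rho> unfolding 1 by linarith
    next
      case 2
      then have "z $ j = of_int \<lfloor>x $ q / \<rho>\<rfloor> * \<rho> + b / 2"
        by (simp add: z_def)
      then show ?thesis
        using round[OF pos(2), of "x $ q"] b_\<rho> pos(1) unfolding 2(1) by linarith
    next
      case 3
      then show ?thesis
        using pos by (simp add: z_def)
    qed
  qed
  have y_x: "\<bar>y $ j - x $ j\<bar> \<le> 2 * \<rho>" if "y \<in> cube z (b / 2)" for y j
  proof -
    have "\<bar>y $ j - z $ j\<bar> \<le> b / 2"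
      using that by (simp add: cube_def)
    then show ?thesis
      using z_x[of j] b_\<rho> pos by linarith
  qed
  have near: "y + t *\<^sub>R e \<in> cube centre (1 / 8 - 6 * len i)"
    if y: "\<And>j. \<bar>y $ j - x $ j\<bar> \<le> 2 * \<rho>" and t: "0 \<le> t" "t \<le> len i" for y t
  proof -
    have "\<bar>(y + t *\<^sub>R e) $ j - 1 / 2\<bar> \<le> 1 / 8 - 6 * len i" for j
    proof -
      have "\<bar>t * e $ j\<bar> \<le> len i"
        using t by (simp add: axis_def)
      moreover have "\<bar>x $ j - 1 / 2\<bar> \<le> 1 / 8 - 8 * len i"
        using x by (simp add: cube_def)
      moreover have "(y + t *\<^sub>R e) $ j = y $ j + t * e $ j"
        by simp
      ultimately show ?thesis
        using y[of j] \<rho>_len_le by linarith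
    qed
    then show ?thesis
      by (simp add: cube_def)
  qed
  have near_core: "y + t *\<^sub>R e \<in> core"
    if "\<And>j. \<bar>y $ j - x $ j\<bar> \<le> 2 * \<rho>" "0 \<le> t" "t \<le> len i" for y t
    using near[OF that] cube_mono[of "1 / 8 - 6 * len i" "1 / 4" centre] pos by auto
  have kb: "real k * b \<le> len i" if "k \<le> N" for k
    using mult_right_mono[of "real k" "real N" b] that pos Nb by simp
  have node_core: "y + (real k * b) *\<^sub>R e \<in> core" if "y \<in> cube z (b / 2)" "k \<le> N" for y k
    using near_core[OF y_x[OF that(1)]] kb[OF that(2)] pos by simp
  have y_core: "y \<in> core" if "y \<in> cube z (b / 2)" for y
    using node_core[OF that, of 0] by simp

  define Q where "Q n y = \<omega> (y + (real (Suc n) * b) *\<^sub>R e) - \<omega> (y + (real n * b) *\<^sub>R e)" for n y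
  define v where "v = (1 / real N) *\<^sub>R (\<omega> (x + len i *\<^sub>R e) - \<omega> x)"
  let ?W = "cube z (b / 2)"
  have bending: "(b / 3) ^ (?D + 1) / 4 \<le> ?D * (\<integral>y. indicator ?W y * norm (Q n y - v) \<partial>lborel)"
    if n: "n < N" for n
    unfolding Q_def b_def
  proof (rule oscillation_forces_bending[OF i(1,2), where m = "\<lfloor>x $ p / (2 * b)\<rfloor>"])
    show "z $ p = 2 * len (Suc i) * of_int \<lfloor>x $ p / (2 * b)\<rfloor>"
      by (simp add: z_def b_def)
    fix y
    show "y + (real n * len (Suc i)) *\<^sub>R e \<in> core" "y + (real (Suc n) * len (Suc i)) *\<^sub>R e \<in> core"
      if "y \<in> cube z (len (Suc i) / 2)"
      using node_core[of y n] node_core[of y "Suc n"] that n by (simp_all only: b_def Suc_leI less_imp_le)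
  next
    fix t assume t: "\<bar>t - z $ q\<bar> \<le> len (Suc i) / 3"
    define k where "k = \<lfloor>x $ q / \<rho>\<rfloor>"
    have "z $ q = of_int k * \<rho> + b / 2"
      using p q by (auto simp: z_def k_def)
    then have t': "of_int k * \<rho> \<le> t" "t < of_int k * \<rho> + b"
      using t pos by (simp_all only: b_def abs_le_iff) linarith+
    have "\<lfloor>t / \<rho>\<rfloor> = k"
    proof (rule floor_unique)
      show "of_int k \<le> t / \<rho>"
        using t' pos by (simp add: pos_le_divide_eq)
      have "t < of_int k * \<rho> + \<rho>"
        using t' b_\<rho> pos by linarith
      then show "t / \<rho> < of_int k + 1"
        using pos by (simp add: pos_divide_less_eq distrib_right)
    qed
    then show "t \<in> strip i"
      using t' by (simp add: strip_iff \<rho>_def b_def)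
  qed
  have int: "integrable lborel (\<lambda>y. indicator ?W y * norm (Q n y - v))" if "n < N" for n
  proof -
    have "continuous_on ?W (\<lambda>y. \<omega> (y + (real k * b) *\<^sub>R e))" if "k \<le> N" for k
    proof (rule continuous_on_compose2[OF lipschitz_on_continuous_on[OF lipschitz]])
      show "continuous_on ?W (\<lambda>y. y + (real k * b) *\<^sub>R e)"
        by (intro continuous_intros)
      show "(\<lambda>y. y + (real k * b) *\<^sub>R e) ` ?W \<subseteq> unit_cube"
        using node_core[OF _ that] core_subset by blast
    qed
    from this[of n] this[of "Suc n"] have "continuous_on ?W (\<lambda>y. norm (Q n y - v))"
      unfolding Q_def using that by (intro continuous_intros) (simp_all add: less_imp_le Suc_leI del: of_nat_Suc)
    from borel_integrable_compact[OF compact_cube this] show ?thesis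
      by simp
  qed
  \<comment> \<open>a single \<open>y\<close> serves all \<open>N\<close> pieces, because the lower bound holds for the sum of the means over \<open>y\<close>\<close>
  obtain y where y: "y \<in> ?W" and y_sum: "real N * c * b < (\<Sum>n<N. norm (Q n y - v))"
  proof (rule ccontr)
    assume "\<not> thesis"
    with that have le: "(\<Sum>n<N. norm (Q n y - v)) \<le> real N * c * b" if "y \<in> ?W" for y
      using not_le \<open>y \<in> ?W\<close> by blast
    \<comment> \<open>\<open>growth\<close> is chosen to leave a factor of two between the two bounds\<close>
    have "real N * ((b / 3) ^ (?D + 1) / 4) \<le> (\<Sum>n<N. ?D * (\<integral>y. indicator ?W y * norm (Q n y - v) \<partial>lborel))"
      using sum_bounded_below[of "{..<N}" "(b / 3) ^ (?D + 1) / 4"] bending by simp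
    also have "\<dots> = ?D * (\<integral>y. (\<Sum>n<N. indicator ?W y * norm (Q n y - v)) \<partial>lborel)"
      using int by (subst Bochner_Integration.integral_sum) (simp_all add: sum_distrib_left)
    also have "\<dots> \<le> ?D * (\<integral>y. indicator ?W y * (real N * c * b) \<partial>lborel)"
    proof (intro mult_left_mono integral_mono)
      show "integrable lborel (\<lambda>y. \<Sum>n<N. indicator ?W y * norm (Q n y - v))"
        using int by (intro Bochner_Integration.integrable_sum) simp
      show "integrable lborel (\<lambda>y. indicator ?W y * (real N * c * b))"
        using emeasure_cube_finite by (intro integrable_mult_left integrable_real_indicator) auto
      show "(\<Sum>n<N. indicator ?W y * norm (Q n y - v)) \<le> indicator ?W y * (real N * c * b)" for y
        using le[of y] by (auto simp: indicator_def)
    qed simp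
    also have "\<dots> = ?D * (b ^ ?D * (real N * c * b))"
      using pos by (simp add: measure_cube)
    also have "\<dots> = real N * ((b / 3) ^ (?D + 1) / 8)"
      by (simp add: c_def growth_def power_divide field_simps)
    finally have "(b / 3) ^ (?D + 1) / 4 \<le> (b / 3) ^ (?D + 1) / 8"
      using pos by simp
    moreover have "0 < (b / 3) ^ (?D + 1)"
      using pos by simp
    ultimately show False
      by linarith
  qed

  have var: "real N * (c * b)\<^sup>2 \<le> (\<Sum>n<N. (norm (Q n y - v))\<^sup>2)"
  proof -
    have "(real N * c * b)\<^sup>2 \<le> (\<Sum>n<N. norm (Q n y - v))\<^sup>2"
      using y_sum pos c0 by (intro power_mono) auto
    also have "\<dots> \<le> (\<Sum>n<N. (norm (Q n y - v))\<^sup>2) * real N"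
      using sum_squared_le_sum_of_squares[of "\<lambda>n. norm (Q n y - v)" "{..<N}"] by simp
    finally have "real N * (real N * (c * b)\<^sup>2) \<le> real N * (\<Sum>n<N. (norm (Q n y - v))\<^sup>2)"
      by (simp add: power2_eq_square mult_ac)
    then show ?thesis
      using pos by (simp only: mult_le_cancel_left_pos of_nat_0_less_iff)
  qed
  have drift: "norm ((\<Sum>n<N. Q n y) - real N *\<^sub>R v) \<le> real N * (4 * L * ?D * b * (1 / 2) ^ i)"
  proof -
    have "(\<Sum>n<N. Q n y) = \<omega> (y + len i *\<^sub>R e) - \<omega> y"
      using sum_lessThan_telescope[of "\<lambda>n. \<omega> (y + (real n * b) *\<^sub>R e)" N] Nb by (simp add: Q_def)
    moreover have "real N *\<^sub>R v = \<omega> (x + len i *\<^sub>R e) - \<omega> x"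
      using pos by (simp add: v_def)
    ultimately have "norm ((\<Sum>n<N. Q n y) - real N *\<^sub>R v)
        = norm ((\<omega> (y + len i *\<^sub>R e) - \<omega> (x + len i *\<^sub>R e)) - (\<omega> y - \<omega> x))"
      by (simp only:) (simp add: algebra_simps)
    also have "\<dots> \<le> norm (\<omega> (y + len i *\<^sub>R e) - \<omega> (x + len i *\<^sub>R e)) + norm (\<omega> y - \<omega> x)"
      by (rule norm_triangle_ineq4)
    also have "\<dots> \<le> L * norm (y + len i *\<^sub>R e - (x + len i *\<^sub>R e)) + L * norm (y - x)"
      using near_core[of x "len i"] near_core[of x 0] near_core[of y "len i"] y_core[OF y] y_x[OF y] pos
      by (intro add_mono \<omega>_lipschitz) auto
    also have "\<dots> = 2 * L * norm (y - x)"
      by simp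
    also have "\<dots> \<le> 2 * L * (?D * (2 * \<rho>))"
    proof (rule mult_left_mono)
      have "(\<Sum>j\<in>UNIV. \<bar>(y - x) $ j\<bar>) \<le> of_nat ?D * (2 * \<rho>)"
        using y_x[OF y] by (intro sum_bounded_above) simp
      then show "norm (y - x) \<le> ?D * (2 * \<rho>)"
        by (rule order_trans[OF norm_le_l1_cart])
    qed (use L_nonneg in simp)
    also have "\<dots> = real N * (4 * L * ?D * b * (1 / 2) ^ i)"
      by (simp add: \<rho>_len flip: Nb)
    finally show ?thesis .
  qed
  have v_eq: "norm v = slope i x * b"
  proof -
    have "norm v = norm (\<omega> (x + len i *\<^sub>R e) - \<omega> x) / real N"
      by (simp add: v_def)
    also have "\<dots> = slope i x * b"
      using pos(1) by (simp flip: Nb)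
    finally show ?thesis .
  qed
  have "norm (\<omega> (x + len i *\<^sub>R e) - \<omega> x) \<le> L * norm (x + len i *\<^sub>R e - x)"
    using near_core[of x "len i"] near_core[of x 0] pos by (intro \<omega>_lipschitz) auto
  then have "norm v \<le> L * b"
    using pos by (simp add: v_eq pos_divide_le_eq)
  from exists_longer_increment[OF pos(4) var drift this]
  obtain n where n: "n < N"
    and le: "(norm v)\<^sup>2 + (c * b)\<^sup>2 - 2 * (L * b) * (4 * L * ?D * b * (1 / 2) ^ i) \<le> (norm (Q n y))\<^sup>2"
    by blast
  define x' where "x' = y + (real n * b) *\<^sub>R e"
  have "b\<^sup>2 * (8 * L\<^sup>2 * ?D * (1 / 2) ^ i) \<le> b\<^sup>2 * (c\<^sup>2 / 2)"
    using i(3) by (intro mult_left_mono) auto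
  then have "(slope i x * b)\<^sup>2 + b\<^sup>2 * (c\<^sup>2 / 2) \<le> (norm (Q n y))\<^sup>2"
    using le by (simp add: v_eq power2_eq_square algebra_simps)
  also have "Q n y = \<omega> (x' + len (Suc i) *\<^sub>R e) - \<omega> x'"
    by (simp add: Q_def x'_def b_def algebra_simps)
  finally have "((slope i x)\<^sup>2 + c\<^sup>2 / 2) * b\<^sup>2 \<le> (norm (\<omega> (x' + len (Suc i) *\<^sub>R e) - \<omega> x'))\<^sup>2"
    by (simp only: power_mult_distrib distrib_right mult.commute[of "c\<^sup>2 / 2"])
  then have "(slope i x)\<^sup>2 + c\<^sup>2 / 2 \<le> (slope (Suc i) x')\<^sup>2"
    using pos by (simp add: power_divide pos_le_divide_eq flip: b_def)
  moreover have "x' \<in> cube centre (1 / 8 - 8 * len (Suc i))"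
  proof -
    have "8 * len (Suc i) \<le> 6 * len i"
      using b_\<rho> \<rho>_len_le pos by (simp only: b_def)
    moreover have "x' \<in> cube centre (1 / 8 - 6 * len i)"
      unfolding x'_def using near[OF y_x[OF y]] kb[of n] n pos by simp
    ultimately show ?thesis
      using cube_mono[of "1 / 8 - 6 * len i" "1 / 8 - 8 * len (Suc i)" centre] by auto
  qed
  ultimately show ?thesis
    by blast
qed

text \<open>
  Each step adds the same amount to the squared slope, which is at most \<open>L\<^sup>2\<close>.
\<close>

lemma no_lipschitz_primitive: False
proof -
  let ?c = "growth CARD('n)"
  have c0: "0 < ?c"
    by (simp add: growth_def)
  have "eventually (\<lambda>i. C * (1 / 2) ^ i \<le> \<epsilon>) sequentially" if "0 < \<epsilon>" for C \<epsilon> :: real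
  proof -
    have "(\<lambda>i. C * (1 / 2) ^ i) \<longlonglongrightarrow> C * 0"
      by (intro tendsto_mult tendsto_const LIMSEQ_power_zero) simp
    then have "eventually (\<lambda>i. C * (1 / 2) ^ i < \<epsilon>) sequentially"
      using that by (intro order_tendstoD(2)[of _ 0]) simp_all
    then show ?thesis
      by eventually_elim simp
  qed
  from this[of 1 "24 * 2 ^ CARD('n)"] this[of "?c\<^sup>2 / 2" "8 * L\<^sup>2 * CARD('n)"] eventually_ge_at_top[of 3]
  have "eventually (\<lambda>i. 24 * 2 ^ CARD('n) * (1 / 2) ^ i \<le> (1 :: real) \<and>
      8 * L\<^sup>2 * CARD('n) * (1 / 2) ^ i \<le> ?c\<^sup>2 / 2 \<and> 3 \<le> i) sequentially"
    using c0 by (simp add: eventually_conj_iff)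
  then obtain i0 where i0: "\<And>i. i0 \<le> i \<Longrightarrow> 24 * 2 ^ CARD('n) * (1 / 2) ^ i \<le> (1 :: real)"
    "\<And>i. i0 \<le> i \<Longrightarrow> 8 * L\<^sup>2 * CARD('n) * (1 / 2) ^ i \<le> ?c\<^sup>2 / 2" "3 \<le> i0"
    by (auto simp: eventually_sequentially)
  have *: "\<exists>x \<in> cube centre (1 / 8 - 8 * len (i0 + m)). real m * (?c\<^sup>2 / 2) \<le> (slope (i0 + m) x)\<^sup>2" for m
  proof (induction m)
    case 0
    have "3 * 2 \<le> i0 * (i0 - 1)"
      using i0(3) by (intro mult_le_mono) auto
    then have "len i0 \<le> (1 / 2) ^ (3 * 2)"
      unfolding len_def by (intro power_decreasing) auto
    then have "len i0 \<le> 1 / 64"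
      by (simp add: power_divide)
    then have "centre \<in> cube centre (1 / 8 - 8 * len i0)"
      by (simp add: cube_def)
    then show ?case
      by auto
  next
    case (Suc m)
    then obtain x where x: "x \<in> cube centre (1 / 8 - 8 * len (i0 + m))"
      and le: "real m * (?c\<^sup>2 / 2) \<le> (slope (i0 + m) x)\<^sup>2"
      by blast
    have "1 \<le> i0 + m"
      using i0(3) by simp
    from slope_grows[OF this i0(1)[OF le_add1] i0(2)[OF le_add1] x]
    obtain x' where "x' \<in> cube centre (1 / 8 - 8 * len (i0 + Suc m))"
      and "(slope (i0 + m) x)\<^sup>2 + ?c\<^sup>2 / 2 \<le> (slope (i0 + Suc m) x')\<^sup>2"
      by (auto simp only: add_Suc_right)
    moreover have "real (Suc m) * (?c\<^sup>2 / 2) = real m * (?c\<^sup>2 / 2) + ?c\<^sup>2 / 2"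
      by (simp only: of_nat_Suc distrib_right mult_1 add.commute)
    ultimately show ?case
      using le by (intro bexI[of _ x']) linarith+
  qed
  have bound: "(slope i x)\<^sup>2 \<le> L\<^sup>2" if "x \<in> cube centre (1 / 8 - 8 * len i)" for i x
  proof -
    have x: "\<bar>x $ j - 1 / 2\<bar> \<le> 1 / 8 - 8 * len i" for j
      using that by (simp add: cube_def)
    have "\<bar>(x + t *\<^sub>R e) $ j - 1 / 2\<bar> \<le> 1 / 4" if "0 \<le> t" "t \<le> len i" for t j
    proof -
      have "\<bar>t * e $ j\<bar> \<le> len i"
        using that by (simp add: axis_def)
      moreover have "(x + t *\<^sub>R e) $ j = x $ j + t * e $ j"
        by simp
      ultimately show ?thesis
        using x[of j] len_pos[of i] by linarith
    qed
    from this[of 0] this[of "len i"] have "x \<in> core" "x + len i *\<^sub>R e \<in> core"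
      using len_pos[of i] by (simp_all add: cube_def less_imp_le)
    then have "slope i x \<le> L"
      using \<omega>_lipschitz[of "x + len i *\<^sub>R e" x] len_pos[of i] by (simp add: pos_divide_le_eq)
    then show ?thesis
      using len_pos[of i] by (intro power_mono) simp_all
  qed
  obtain m :: nat where "L\<^sup>2 < real m * (?c\<^sup>2 / 2)"
    using ex_less_of_nat_mult[of "?c\<^sup>2 / 2" "L\<^sup>2"] c0 by auto
  with *[of m] bound show False
    by fastforce
qed

end

section \<open>The theorem\<close>

theorem theorem7p1:
  fixes k :: nat
  assumes "1 \<le> k" and "k \<le> CARD('n::{finite,linorder}) - 1"
  shows "\<exists>\<eta> :: real ^ 'n::{finite,linorder} \<Rightarrow> real ^ ('n set).
    \<eta> \<in> L_infinity_closed (k + 1) \<and>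
    (AE x in lebesgue. x \<notin> unit_cube \<longrightarrow> \<eta> x = 0) \<and>
    \<not> (\<exists>\<omega> :: real ^ 'n::{finite,linorder} \<Rightarrow> real ^ ('n set).
          lipschitz_form_on unit_cube k \<omega> \<and>
          (AE x in lebesgue. x \<in> unit_cube \<longrightarrow> has_exterior_derivative_at \<omega> (\<eta> x) x))"
proof -
  have "k + 1 \<le> card (UNIV :: 'n set)"
    using assms by simp
  then obtain J :: "'n set" where J: "card J = k + 1"
    by (meson obtain_subset_with_card_n)
  then obtain p where p: "p \<in> J"
    by (metis card.empty ex_in_conv add_is_0 one_neq_zero)
  define I where "I = J - {p}"
  have I: "card I = k" "p \<notin> I"
    using J p by (auto simp: I_def)
  then obtain q where q: "q \<in> I"
    using assms(1) by (metis card.empty ex_in_conv not_one_le_zero)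
  let ?\<eta> = "potential_form I (potential_deriv p q)"
  show ?thesis
  proof (intro exI conjI)
    have "?\<eta> \<in> L_infinity_closed (card I + 1)"
      using q by (intro potential_form_closed[OF borel_measurable_potential[of p q] abs_potential_le
            borel_measurable_potential_deriv abs_potential_deriv_le]
          has_partial_derivative_potential) auto
    then show "?\<eta> \<in> L_infinity_closed (k + 1)"
      by (simp add: I)
    show "AE x in lebesgue. x \<notin> unit_cube \<longrightarrow> ?\<eta> x = 0"
      by (intro AE_I2)
        (auto simp: potential_form_def potential_deriv_def cutoff_outside_unit_cube intro!: sum.neutral)
    show "\<not> (\<exists>\<omega> :: real ^ 'n::{finite,linorder} \<Rightarrow> real ^ ('n set).
        lipschitz_form_on unit_cube k \<omega> \<and>
        (AE x in lebesgue. x \<in> unit_cube \<longrightarrow> has_exterior_derivative_at \<omega> (?\<eta> x) x))"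
    proof
      assume "\<exists>\<omega> :: real ^ 'n::{finite,linorder} \<Rightarrow> real ^ ('n set).
        lipschitz_form_on unit_cube k \<omega> \<and>
        (AE x in lebesgue. x \<in> unit_cube \<longrightarrow> has_exterior_derivative_at \<omega> (?\<eta> x) x)"
      then obtain \<omega> :: "real ^ 'n::{finite,linorder} \<Rightarrow> real ^ ('n set)" and L
        where L: "L-lipschitz_on unit_cube \<omega>"
          and d: "AE x in lebesgue. x \<in> unit_cube \<longrightarrow> has_exterior_derivative_at \<omega> (?\<eta> x) x"
        unfolding lipschitz_form_on_def by blast
      have "AE x in lborel. x \<in> unit_cube \<longrightarrow> has_exterior_derivative_at \<omega> (?\<eta> x) x"
        using d by (simp only: AE_completion_iff)
      then interpret lipschitz_primitive p q I \<omega> L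
        using I q L by unfold_locales auto
      show False
        by (rule no_lipschitz_primitive)
    qed
  qed
qed

end
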